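(* Let $(W,S)$ be a Coxeter system with $S$ finite. Suppose that $s_1\in S$ is a pseudo-transposition and let $s_0\in S$ be the unique element such that $m_S(s_0,s_1)=2(2k+1)$ with $k\geq 1$. Set $$s_2:=s_1s_0s_1,\qquad r:=(s_1s_0)^{2k+1}$$ and $$T:=(S\setminus\{s_1\})\cup\{s_2,r\}.$$ Then $$\omega(W,T)\geq\omega(W,S).$$
   Context: For a group $G$ with finite generating set $S$, let $\ell_S(g)=\min\{n\in\mathbb{N}\mid g=s_1\cdots s_n,\ s_i\in S\cup S^{-1}\}$ be the word length, and define the exponential growth rate $$\omega(G,S)=\limsup_{n\to\infty}\sqrt[n]{|\{g\in G\mid \ell_S(g)=n\}|}.$$ A Coxeter system $(W,S)$ consists of a group $W$ and a finite generating set $S$ such that $W$ has the presentation $\langle S\mid (st)^{m_S(s,t)}=e \text{ for all } s,t\in S \text{ with } m_S(s,t)<\infty\rangle$, where $m_S(s,t)\in\mathbb{N}\cup\{\infty\}$ is the order of $st$ in $W$, $m_S(s,s)=1$, and $m_S(s,t)\geq 2$ for $s\neq t$. An element $s_1\in S$ is called a pseudo-transposition if the following conditions are satisfied: (1) there exists a unique $s_0\in S$ such that $m_S(s_0,s_1)=2(2k+1)$ for some integer $k\geq 1$; (2) for every $s\in S\setminus\{s_0,s_1\}$ we have $m_S(s,s_1)\in\{2,\infty\}$; (3) if $s\in S\setminus\{s_0,s_1\}$ satisfies $m_S(s,s_1)=2$, then $m_S(s,s_0)=2$. It is a known fact (Mühlherr) that the set $T$ in the claim is again a Coxeter generating set of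 $W$; in particular $T$ generates $W$. *)

theory Defs
  imports "HOL-Algebra.Algebra" "HOL-Library.Extended_Nat" "HOL-Library.Extended_Real"
    "HOL-Library.Liminf_Limsup"
begin

section \<open>Word length and exponential growth rate\<close>

definition word_prod :: "('a, 'b) monoid_scheme \<Rightarrow> 'a list \<Rightarrow> 'a" where
  "word_prod G xs = foldr (\<otimes>\<^bsub>G\<^esub>) xs \<one>\<^bsub>G\<^esub>"

text \<open>The length is only meaningful for elements of the subgroup generated by \<open>S\<close>; elsewhere
  \<open>LEAST\<close> ranges over the empty set and the value is unspecified.\<close>

definition word_length :: "('a, 'b) monoid_scheme \<Rightarrow> 'a set \<Rightarrow> 'a \<Rightarrow> nat" where
  "word_length G S g =
     (LEAST n. \<exists>xs. length xs = n \<and> set xs \<subseteq> S \<union> (\<lambda>s. inv\<^bsub>G\<^esub> s) ` S \<and> g = word_prod G xs)"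

text \<open>The limit superior is taken in the extended reals, where it always exists. For finite \<open>S\<close>
  it is a real number, since there are at most \<open>(2 * card S) ^ n\<close> elements of length \<open>n\<close>. The
  junk value \<open>root 0 x = 0\<close> does not affect it.\<close>

definition growth_rate :: "('a, 'b) monoid_scheme \<Rightarrow> 'a set \<Rightarrow> ereal" where
  "growth_rate G S =
     limsup (\<lambda>n. ereal (root n (real (card {g \<in> carrier G. word_length G S g = n}))))"

section \<open>Group presentations\<close>

text \<open>A letter \<open>(s, True)\<close> stands for the generator \<open>s\<close> and \<open>(s, False)\<close> for its formal inverse.
  Two words over \<open>S\<close> are equivalent modulo a set \<open>R\<close> of relators if they are connected by finitely
  many insertions and deletions of subwords of the form \<open>s s\<inverse>\<close>, \<open>s\<inverse> s\<close> or \<open>r \<in> R\<close>; the group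
  \<open>\<langle>S | R\<rangle>\<close> consists of the equivalence classes, multiplied by concatenation. The parameter \<open>R\<close> is
  meant to be a set of words over \<open>S\<close>.\<close>

type_synonym 'a gword = "('a \<times> bool) list"

abbreviation gwords :: "'a set \<Rightarrow> 'a gword set" where
  "gwords S \<equiv> lists (S \<times> UNIV)"

inductive_set word_equiv :: "'a set \<Rightarrow> 'a gword set \<Rightarrow> ('a gword \<times> 'a gword) set"
  for S :: "'a set" and R :: "'a gword set" where
  refl: "w \<in> gwords S \<Longrightarrow> (w, w) \<in> word_equiv S R"
| sym: "(v, w) \<in> word_equiv S R \<Longrightarrow> (w, v) \<in> word_equiv S R"
| trans: "(u, v) \<in> word_equiv S R \<Longrightarrow> (v, w) \<in> word_equiv S R \<Longrightarrow> (u, w) \<in> word_equiv S R"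
| cancel: "u \<in> gwords S \<Longrightarrow> v \<in> gwords S \<Longrightarrow> s \<in> S
    \<Longrightarrow> (u @ [(s, b), (s, \<not> b)] @ v, u @ v) \<in> word_equiv S R"
| relator: "u \<in> gwords S \<Longrightarrow> v \<in> gwords S \<Longrightarrow> r \<in> R \<Longrightarrow> (u @ r @ v, u @ v) \<in> word_equiv S R"

definition presented_group :: "'a set \<Rightarrow> 'a gword set \<Rightarrow> 'a gword set monoid" where
  "presented_group S R =
     \<lparr>carrier = gwords S // word_equiv S R,
      monoid.mult = (\<lambda>A B. \<Union>u\<in>A. \<Union>v\<in>B. word_equiv S R `` {u @ v}),
      monoid.one = word_equiv S R `` {[]}\<rparr>"

text \<open>For \<open>S \<subseteq> carrier G\<close>, the group \<open>G\<close> has the presentation \<open>\<langle>S | R\<rangle>\<close> if the inclusion of \<open>S\<close>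
  extends to an isomorphism from \<open>\<langle>S | R\<rangle>\<close> onto \<open>G\<close>.\<close>

definition has_presentation :: "('a, 'b) monoid_scheme \<Rightarrow> 'a set \<Rightarrow> 'a gword set \<Rightarrow> bool" where
  "has_presentation G S R \<longleftrightarrow>
     (\<exists>h \<in> iso (presented_group S R) G. \<forall>s\<in>S. h (word_equiv S R `` {[(s, True)]}) = s)"

section \<open>Coxeter systems\<close>

text \<open>\<open>group.ord\<close> is \<open>0\<close> on elements of infinite order.\<close>

definition coxeter_m :: "('a, 'b) monoid_scheme \<Rightarrow> 'a \<Rightarrow> 'a \<Rightarrow> enat" where
  "coxeter_m W s t =
     (if group.ord W (s \<otimes>\<^bsub>W\<^esub> t) = 0 then \<infinity> else enat (group.ord W (s \<otimes>\<^bsub>W\<^esub> t)))"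

definition coxeter_relators :: "('a, 'b) monoid_scheme \<Rightarrow> 'a set \<Rightarrow> 'a gword set" where
  "coxeter_relators W S =
     {concat (replicate n [(s, True), (t, True)]) | n s t. s \<in> S \<and> t \<in> S \<and> coxeter_m W s t = enat n}"

definition coxeter_system :: "('a, 'b) monoid_scheme \<Rightarrow> 'a set \<Rightarrow> bool" where
  "coxeter_system W S \<longleftrightarrow>
     group W \<and> finite S \<and> S \<subseteq> carrier W \<and> generate W S = carrier W \<and>
     (\<forall>s\<in>S. coxeter_m W s s = 1) \<and>
     (\<forall>s\<in>S. \<forall>t\<in>S. s \<noteq> t \<longrightarrow> coxeter_m W s t \<ge> 2) \<and>
     has_presentation W S (coxeter_relators W S)"

definition pseudo_transposition :: "('a, 'b) monoid_scheme \<Rightarrow> 'a set \<Rightarrow> 'a \<Rightarrow> bool" where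
  "pseudo_transposition W S s1 \<longleftrightarrow> s1 \<in> S \<and>
     (\<exists>!s0. s0 \<in> S \<and> (\<exists>k::nat. k \<ge> 1 \<and> coxeter_m W s0 s1 = enat (2 * (2 * k + 1)))) \<and>
     (\<forall>s0\<in>S. (\<exists>k::nat. k \<ge> 1 \<and> coxeter_m W s0 s1 = enat (2 * (2 * k + 1))) \<longrightarrow>
        (\<forall>s \<in> S - {s0, s1}. coxeter_m W s s1 \<in> {2, \<infinity>}) \<and>
        (\<forall>s \<in> S - {s0, s1}. coxeter_m W s s1 = 2 \<longrightarrow> coxeter_m W s s0 = 2))"

end

theory Submission
  imports Defs
begin

text \<open>Write \<open>a = s\<^sub>0\<close>, \<open>b = s\<^sub>1\<close>, let \<open>D\<close> be the dihedral group generated by \<open>a\<close> and \<open>b\<close>, and let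
  \<open>J\<close> be the set of the generators other than \<open>a\<close> and \<open>b\<close> that commute with \<open>b\<close>, hence with \<open>D\<close>.
  There is a bijection \<open>f\<close> of \<open>D\<close> with \<open>f \<one> = \<one>\<close> and \<open>f (a d) = a f d\<close> such that the \<open>T\<close>-length of
  \<open>f d\<close> is at most the \<open>S\<close>-length of \<open>d\<close>. Choosing representatives \<open>h\<close> of minimal length in the right
  cosets of \<open>D \<times> W\<^sub>J\<close>, let \<open>b\<close> act on \<open>W\<close> by \<open>d v h \<mapsto> f\<inverse>(b f(d)) v h\<close> for \<open>d \<in> D\<close> and \<open>v \<in> W\<^sub>J\<close>,
  and all other generators by left multiplication. Since \<open>f\<close> commutes with \<open>a\<close> and no generator outside
  \<open>J \<union> {a, b}\<close> has a relation with \<open>b\<close>, this respects the Coxeter relations. Let \<open>\<psi> x\<close> be the result of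
  letting \<open>x\<close> act on \<open>\<one>\<close>. By induction on the length, every \<open>g \<in> W\<close> has a preimage under \<open>\<psi>\<close> whose
  \<open>T\<close>-length is at most the \<open>S\<close>-length of \<open>g\<close>: if \<open>g = d v h\<close> and \<open>\<psi> x = h\<close>, then
  \<open>\<psi> (f(d) v x) = g\<close>. So balls with respect to \<open>T\<close> are at least as large as balls with respect to
  \<open>S\<close>.\<close>

section \<open>Coxeter groups acting on sets\<close>

lemma word_prod_Nil [simp]: "word_prod G [] = \<one>\<^bsub>G\<^esub>"
  by (simp add: word_prod_def)

lemma word_prod_Cons [simp]: "word_prod G (x # xs) = x \<otimes>\<^bsub>G\<^esub> word_prod G xs"
  by (simp add: word_prod_def)

lemma (in monoid) word_prod_closed [simp]:
  "set xs \<subseteq> carrier G \<Longrightarrow> word_prod G xs \<in> carrier G"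
  by (induction xs) auto

lemma (in monoid) word_prod_append:
  "set xs \<subseteq> carrier G \<Longrightarrow> set ys \<subseteq> carrier G
    \<Longrightarrow> word_prod G (xs @ ys) = word_prod G xs \<otimes> word_prod G ys"
  by (induction xs) (auto simp: m_assoc)

lemma word_equiv_gwords:
  assumes "(u, v) \<in> word_equiv S R" "R \<subseteq> gwords S"
  shows "u \<in> gwords S \<and> v \<in> gwords S"
  using assms by induction (auto simp: subset_iff)

lemma word_equiv_context:
  assumes "(u, v) \<in> word_equiv S R" "p \<in> gwords S" "q \<in> gwords S"
  shows "(p @ u @ q, p @ v @ q) \<in> word_equiv S R"
  using assms
proof induction
  case (refl w)
  then show ?case by (auto intro!: word_equiv.refl)
next
  case (sym v w)
  then show ?case by (auto intro: word_equiv.sym)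
next
  case (trans u v w)
  then show ?case by (auto intro: word_equiv.trans)
next
  case (cancel u v s b)
  then show ?case
    using word_equiv.cancel[where u = "p @ u" and v = "v @ q" and s = s and b = b] by auto
next
  case (relator u v r)
  then show ?case
    using word_equiv.relator[where u = "p @ u" and v = "v @ q" and r = r] by auto
qed

lemma equiv_word_equiv:
  assumes "R \<subseteq> gwords S"
  shows "equiv (gwords S) (word_equiv S R)"
  using word_equiv_gwords[OF _ assms]
  by (intro equivI refl_onI symI transI)
    (auto intro: word_equiv.refl word_equiv.sym word_equiv.trans)

text \<open>Equivalence is compatible with concatenation on both sides, so the double union in the
  definition of the product runs over copies of a single class.\<close>

lemma presented_group_mult:
  assumes R: "R \<subseteq> gwords S" and u: "u \<in> gwords S" and v: "v \<in> gwords S"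
  shows "word_equiv S R `` {u} \<otimes>\<^bsub>presented_group S R\<^esub> word_equiv S R `` {v}
    = word_equiv S R `` {u @ v}"
proof -
  let ?E = "word_equiv S R"
  have eq: "?E `` {u' @ v'} = ?E `` {u @ v}" if "u' \<in> ?E `` {u}" "v' \<in> ?E `` {v}" for u' v'
  proof -
    have u': "u' \<in> gwords S"
      using that(1) word_equiv_gwords[OF _ R] by blast
    have "(u @ v, u' @ v) \<in> ?E"
      using word_equiv_context[of u u' S R "[]" v] that v by auto
    moreover have "(u' @ v, u' @ v') \<in> ?E"
      using word_equiv_context[of v v' S R u' "[]"] that u' by auto
    ultimately have "(u @ v, u' @ v') \<in> ?E"
      by (rule word_equiv.trans)
    then show ?thesis
      using equiv_class_eq[OF equiv_word_equiv[OF R]] by blast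
  qed
  have ne: "u \<in> ?E `` {u}" "v \<in> ?E `` {v}"
    using u v by (auto intro: word_equiv.refl)
  have "(\<Union>u'\<in>?E `` {u}. \<Union>v'\<in>?E `` {v}. ?E `` {u' @ v'}) = (\<Union>u'\<in>?E `` {u}. \<Union>v'\<in>?E `` {v}. ?E `` {u @ v})"
    by (intro SUP_cong HOL.refl) (rule eq)
  also have "\<dots> = ?E `` {u @ v}"
    using ne by blast
  finally show ?thesis
    unfolding presented_group_def by simp
qed

text \<open>The isomorphism from the presented group evaluates the class of a positive word to its
  product in \<open>G\<close>. Since it is injective, equal products come from equivalent
  words.\<close>

lemma has_presentation_word_equiv:
  fixes G (structure)
  assumes pres: "has_presentation G S R" and "group G" and R: "R \<subseteq> gwords S"
    and xs: "xs \<in> lists S" and ys: "ys \<in> lists S"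
    and eq: "word_prod G xs = word_prod G ys"
  shows "(map (\<lambda>s. (s, True)) xs, map (\<lambda>s. (s, True)) ys) \<in> word_equiv S R"
proof -
  interpret group G by fact
  let ?E = "word_equiv S R" and ?P = "presented_group S R" and ?w = "map (\<lambda>s. (s, True))"
  obtain h where h: "h \<in> iso ?P G" and gen: "\<And>s. s \<in> S \<Longrightarrow> h (?E `` {[(s, True)]}) = s"
    using pres unfolding has_presentation_def by blast
  have hom: "h (A \<otimes>\<^bsub>?P\<^esub> B) = h A \<otimes> h B" "h A \<in> carrier G"
    if "A \<in> carrier ?P" "B \<in> carrier ?P" for A B
    using h that unfolding iso_def hom_def by auto
  have cls: "?E `` {u} \<in> carrier ?P" if "u \<in> gwords S" for u
    using that unfolding presented_group_def by (auto intro: quotientI)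
  \<comment> \<open>The class of the empty word is idempotent, and the only idempotent of a group is
    the identity.\<close>
  have "h (?E `` {[]}) = h (?E `` {[]}) \<otimes> h (?E `` {[]})"
    using hom(1)[OF cls cls, of "[]" "[]"] presented_group_mult[OF R, of "[]" "[]"] by simp
  then have one: "h (?E `` {[]}) = \<one>"
    using hom(2)[OF cls cls, of "[]" "[]"] by (metis l_cancel_one lists.Nil)
  have val: "h (?E `` {?w zs}) = word_prod G zs" if "zs \<in> lists S" for zs
    using that
  proof (induction zs)
    case Nil
    then show ?case by (simp add: one)
  next
    case (Cons z zs)
    have w: "?w zs \<in> gwords S" "[(z, True)] \<in> gwords S"
      using Cons.hyps by auto
    show ?case
      using hom(1)[OF cls[OF w(2)] cls[OF w(1)]] presented_group_mult[OF R w(2) w(1)]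
        gen[OF Cons.hyps(1)] Cons.IH by simp
  qed
  have w: "?w xs \<in> gwords S" "?w ys \<in> gwords S"
    using xs ys by auto
  have "inj_on h (carrier ?P)"
    using h unfolding iso_def bij_betw_def by blast
  then have "?E `` {?w xs} = ?E `` {?w ys}"
    by (rule inj_onD) (use cls w val[OF xs] val[OF ys] eq in simp_all)
  then show ?thesis
    using eq_equiv_class[OF _ equiv_word_equiv[OF R] w(2)] by blast
qed

section \<open>Actions of a Coxeter group defined on its generators\<close>

lemma foldr_mem:
  "(\<And>s x. s \<in> S \<Longrightarrow> x \<in> Z \<Longrightarrow> \<phi> s x \<in> Z) \<Longrightarrow> set us \<subseteq> S \<Longrightarrow> x \<in> Z \<Longrightarrow> foldr \<phi> us x \<in> Z"
  by (induction us) auto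

text \<open>Each letter acts as an involution, so a generator and its formal inverse act alike; this
  is why \<open>map fst\<close> may forget the signs.\<close>

lemma word_equiv_action:
  assumes "(u, v) \<in> word_equiv S R"
    and closed: "\<And>s x. s \<in> S \<Longrightarrow> x \<in> Z \<Longrightarrow> \<phi> s x \<in> Z"
    and invol: "\<And>s x. s \<in> S \<Longrightarrow> x \<in> Z \<Longrightarrow> \<phi> s (\<phi> s x) = x"
    and rel: "\<And>w x. w \<in> R \<Longrightarrow> x \<in> Z \<Longrightarrow> foldr \<phi> (map fst w) x = x"
    and "x \<in> Z"
  shows "foldr \<phi> (map fst u) x = foldr \<phi> (map fst v) x"
  using assms(1,5)
proof induction
  case (cancel u v s b)
  have "foldr \<phi> (map fst v) x \<in> Z"
    by (rule foldr_mem[where S = S]) (use cancel closed in auto)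
  then show ?case
    using cancel invol by simp
next
  case (relator u v r)
  have "foldr \<phi> (map fst v) x \<in> Z"
    by (rule foldr_mem[where S = S]) (use relator closed in auto)
  then show ?case
    using relator rel by simp
qed auto

lemma foldr_concat_replicate: "foldr f (concat (replicate n us)) = foldr f us ^^ n"
  by (induction n) (auto simp: fun_eq_iff)

locale coxeter = group W for W :: "('a, 'b) monoid_scheme" (structure) +
  fixes S :: "'a set"
  assumes coxeter_system: "coxeter_system W S"
begin

lemma finite_S: "finite S" and S_carrier: "S \<subseteq> carrier W"
  using coxeter_system unfolding coxeter_system_def by auto

lemma S_closed [simp]: "s \<in> S \<Longrightarrow> s \<in> carrier W"
  using S_carrier by auto

lemma sq [simp]: "s \<in> S \<Longrightarrow> s \<otimes> s = \<one>"
proof -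
  assume s: "s \<in> S"
  then have "coxeter_m W s s = 1"
    using coxeter_system unfolding coxeter_system_def by blast
  then have "ord (s \<otimes> s) = 1"
    unfolding coxeter_m_def by (simp add: one_enat_def split: if_splits)
  then show "s \<otimes> s = \<one>"
    using s by (metis ord_eq_1 S_closed m_closed)
qed

lemma sq_left [simp]: "s \<in> S \<Longrightarrow> x \<in> carrier W \<Longrightarrow> s \<otimes> (s \<otimes> x) = x"
  by (simp flip: m_assoc)

lemma inv_S [simp]: "s \<in> S \<Longrightarrow> inv s = s"
  by (simp add: inv_equality)

text \<open>The universal property of the presentation: involutions of \<open>Z\<close> satisfying
  the Coxeter relations make \<open>W\<close> act on \<open>Z\<close>. It is phrased for words, so
  that the action of an element can be computed from any word for it.\<close>

lemma coxeter_action: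
  assumes closed: "\<And>s x. s \<in> S \<Longrightarrow> x \<in> Z \<Longrightarrow> \<phi> s x \<in> Z"
    and invol: "\<And>s x. s \<in> S \<Longrightarrow> x \<in> Z \<Longrightarrow> \<phi> s (\<phi> s x) = x"
    and rel: "\<And>s t n x. s \<in> S \<Longrightarrow> t \<in> S \<Longrightarrow> coxeter_m W s t = enat n \<Longrightarrow> x \<in> Z
      \<Longrightarrow> ((\<phi> s \<circ> \<phi> t) ^^ n) x = x"
    and "set xs \<subseteq> S" "set ys \<subseteq> S" "word_prod W xs = word_prod W ys" "x \<in> Z"
  shows "foldr \<phi> xs x = foldr \<phi> ys x"
proof -
  have R: "coxeter_relators W S \<subseteq> gwords S"
    unfolding coxeter_relators_def by (auto split: if_splits)
  have pres: "has_presentation W S (coxeter_relators W S)"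
    using coxeter_system unfolding coxeter_system_def by blast
  have rel': "foldr \<phi> (map fst w) x = x" if "w \<in> coxeter_relators W S" "x \<in> Z" for w x
  proof -
    obtain n s t where w: "w = concat (replicate n [(s, True), (t, True)])"
      and st: "s \<in> S" "t \<in> S" "coxeter_m W s t = enat n"
      using \<open>w \<in> _\<close> unfolding coxeter_relators_def by blast
    have "map fst w = concat (replicate n [s, t])"
      unfolding w by (simp add: map_concat)
    then show ?thesis
      using rel[OF st \<open>x \<in> Z\<close>] by (simp add: foldr_concat_replicate comp_def)
  qed
  have "xs \<in> lists S" "ys \<in> lists S"
    using assms(4,5) by auto
  from has_presentation_word_equiv[OF pres is_group R this assms(6)]
  have "foldr \<phi> (map fst (map (\<lambda>s. (s, True)) xs)) x = foldr \<phi> (map fst (map (\<lambda>s. (s, True)) ys)) x"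
    by (rule word_equiv_action[where Z = Z]) (fact closed invol rel' \<open>x \<in> Z\<close>)+
  then show ?thesis
    by (simp add: comp_def)
qed

end

section \<open>Inversion sets\<close>

lemma (in group) inv_cancel_left:
  assumes "x \<in> carrier G" "y \<in> carrier G"
  shows "inv x \<otimes> (x \<otimes> y) = y" "x \<otimes> (inv x \<otimes> y) = y"
  using assms by (simp_all flip: m_assoc)

lemma (in group) inv_conj_eq_iff:
  assumes "p \<in> carrier G" "x \<in> carrier G" "y \<in> carrier G"
  shows "inv p \<otimes> x \<otimes> p = y \<longleftrightarrow> x = p \<otimes> y \<otimes> inv p"
  using assms by (auto simp: m_assoc inv_cancel_left)

context coxeter begin

text \<open>The letters act on subsets of \<open>W\<close> by \<open>A \<mapsto> {s} \<triangle> s A s\<close>. The orbit of the empty set consists of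
  the inversion sets, which determine the word length.\<close>

definition flip :: "'a \<Rightarrow> 'a set \<Rightarrow> 'a set" where
  "flip s A = {x \<in> carrier W. (x = s) \<noteq> (s \<otimes> x \<otimes> s \<in> A)}"

lemma conj_eq_iff:
  assumes "s \<in> S" "x \<in> carrier W" "y \<in> carrier W"
  shows "s \<otimes> x \<otimes> s = y \<longleftrightarrow> x = s \<otimes> y \<otimes> s"
  using assms by (auto simp: m_assoc)

lemma flip_flip:
  assumes "s \<in> S" "A \<subseteq> carrier W"
  shows "flip s (flip s A) = A"
  using assms conj_eq_iff[of s _ s] unfolding flip_def by (auto simp: m_assoc)

text \<open>Each round of \<open>s\<close> and \<open>t\<close> toggles two reflections and
  conjugates by \<open>s \<otimes> t\<close>, so \<open>i\<close> rounds toggle the reflections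
  \<open>(s \<otimes> t) [^] j \<otimes> s\<close> with \<open>j < 2 * i\<close>. These may repeat,
  hence the parity of a sum instead of a membership test.\<close>

lemma flip_flip_pow:
  assumes s: "s \<in> S" and t: "t \<in> S" and A: "A \<subseteq> carrier W"
  shows "((flip s \<circ> flip t) ^^ i) A =
    {x \<in> carrier W. odd (\<Sum>j<2 * i. of_bool (x = (s \<otimes> t) [^] j \<otimes> s) :: nat)
      \<noteq> (inv ((s \<otimes> t) [^] i) \<otimes> x \<otimes> (s \<otimes> t) [^] i \<in> A)}"
proof (induction i)
  case 0
  then show ?case
    using A by auto
next
  case (Suc i)
  define p where "p = s \<otimes> t"
  have p: "p \<in> carrier W" and inv_p: "inv p = t \<otimes> s"
    using s t by (auto simp: p_def inv_mult_group)
  have mem: "x \<in> ((flip s \<circ> flip t) ^^ Suc i) A \<longleftrightarrow>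
      odd (\<Sum>j<2 * Suc i. of_bool (x = p [^] j \<otimes> s) :: nat)
        \<noteq> (inv (p [^] Suc i) \<otimes> x \<otimes> p [^] Suc i \<in> A)" if x: "x \<in> carrier W" for x
  proof -
    define y where "y = inv p \<otimes> x \<otimes> p"
    have y: "y \<in> carrier W"
      using x p by (simp add: y_def)
    have y_conv: "t \<otimes> (s \<otimes> x \<otimes> s) \<otimes> t = y"
      unfolding y_def inv_p unfolding p_def using s t x by (simp add: m_assoc)
    \<comment> \<open>Conjugation by \<open>p\<close> shifts the index of a reflection by two,
      because \<open>s \<otimes> inv p = p \<otimes> s\<close>. The vacated indices 0 and 1 belong
      to the reflections toggled in the new round.\<close>
    have y_eq: "y = p [^] j \<otimes> s \<longleftrightarrow> x = p [^] Suc (Suc j) \<otimes> s" for j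
    proof -
      have "y = p [^] j \<otimes> s \<longleftrightarrow> x = p \<otimes> (p [^] j \<otimes> s) \<otimes> inv p"
        using x p s unfolding y_def by (intro inv_conj_eq_iff) auto
      also have "p \<otimes> (p [^] j \<otimes> s) \<otimes> inv p = p [^] Suc j \<otimes> (s \<otimes> inv p)"
        using p s nat_pow_Suc2[OF p, of j] by (simp flip: m_assoc)
      also have "s \<otimes> inv p = p \<otimes> s"
        unfolding inv_p unfolding p_def using s t by (simp add: m_assoc)
      also have "p [^] Suc j \<otimes> (p \<otimes> s) = p [^] Suc (Suc j) \<otimes> s"
        using p s by (simp add: m_assoc)
      finally show ?thesis .
    qed
    have x1: "s \<otimes> x \<otimes> s = t \<longleftrightarrow> x = p [^] Suc 0 \<otimes> s"
      using conj_eq_iff[of s x t] s t x by (simp add: p_def)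
    have x0: "x = s \<longleftrightarrow> x = p [^] (0::nat) \<otimes> s"
      using s by simp
    have conj: "inv (p [^] i) \<otimes> y \<otimes> p [^] i = inv (p [^] Suc i) \<otimes> x \<otimes> p [^] Suc i"
      unfolding nat_pow_Suc2[OF p] using p x by (simp add: y_def inv_mult_group m_assoc)
    have sum: "(\<Sum>j<2 * Suc i. of_bool (x = p [^] j \<otimes> s) :: nat) =
        of_bool (x = p [^] (0::nat) \<otimes> s) + (of_bool (x = p [^] Suc 0 \<otimes> s)
        + (\<Sum>j<2 * i. of_bool (y = p [^] j \<otimes> s)))"
      unfolding y_eq by (simp only: mult_Suc_right add_2_eq_Suc sum.lessThan_Suc_shift)
    have odd: "odd (of_bool P + (of_bool Q + n)) \<longleftrightarrow> P \<noteq> (Q \<noteq> odd n)" for P Q and n :: nat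
      by (cases P; cases Q) simp_all
    have "x \<in> ((flip s \<circ> flip t) ^^ Suc i) A \<longleftrightarrow>
        (x = s) \<noteq> ((s \<otimes> x \<otimes> s = t) \<noteq> (y \<in> ((flip s \<circ> flip t) ^^ i) A))"
      using x s t by (simp add: flip_def flip: y_conv)
    also have "y \<in> ((flip s \<circ> flip t) ^^ i) A \<longleftrightarrow>
        odd (\<Sum>j<2 * i. of_bool (y = p [^] j \<otimes> s) :: nat) \<noteq> (inv (p [^] i) \<otimes> y \<otimes> p [^] i \<in> A)"
      unfolding Suc.IH p_def by (simp only: mem_Collect_eq y simp_thms)
    finally show ?thesis
      unfolding sum x1 conj x0 odd by blast
  qed
  have "((flip s \<circ> flip t) ^^ Suc i) A \<subseteq> carrier W"
    by (auto simp: flip_def)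
  then show ?case
    using mem unfolding p_def by blast
qed

lemma coxeter_m_pow:
  assumes "s \<in> S" "t \<in> S" "coxeter_m W s t = enat n"
  shows "(s \<otimes> t) [^] n = \<one>"
  using assms unfolding coxeter_m_def by (auto split: if_splits)

definition inversions :: "'a list \<Rightarrow> 'a set" where
  "inversions xs = foldr flip xs {}"

lemma inversions_Nil [simp]: "inversions [] = {}"
  and inversions_Cons [simp]: "inversions (s # xs) = flip s (inversions xs)"
  by (simp_all add: inversions_def)

lemma inversions_carrier: "inversions xs \<subseteq> carrier W"
  by (cases xs) (auto simp: flip_def)

text \<open>The reflections \<open>(s \<otimes> t) [^] j \<otimes> s\<close> are periodic in
  \<open>j\<close> with period \<open>n\<close>, the order of \<open>s \<otimes> t\<close>. A full
  relation therefore toggles each of them an even number of times and conjugates by the identity, so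
  the flips satisfy the Coxeter relations.\<close>

lemma inversions_cong:
  assumes "set xs \<subseteq> S" "set ys \<subseteq> S" "word_prod W xs = word_prod W ys"
  shows "inversions xs = inversions ys"
  unfolding inversions_def
proof (rule coxeter_action[where Z = "Pow (carrier W)"])
  fix s t A and n :: nat
  assume st: "s \<in> S" "t \<in> S" "coxeter_m W s t = enat n" and "A \<in> Pow (carrier W)"
  define g :: "'a \<Rightarrow> nat \<Rightarrow> nat" where "g = (\<lambda>x j. of_bool (x = (s \<otimes> t) [^] j \<otimes> s))"
  have pn: "(s \<otimes> t) [^] n = \<one>"
    using coxeter_m_pow st by blast
  have period: "g x (j + n) = g x j" for x j
    using st pn by (simp add: g_def flip: nat_pow_mult)
  have "(\<Sum>j<2 * n. g x j) = (\<Sum>j<n. g x j) + (\<Sum>j<n. g x (j + n))" for x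
    using sum.atLeastLessThan_concat[of 0 n "2 * n" "g x"] sum.shift_bounds_nat_ivl[of "g x" 0 n n]
    by (simp add: atLeast0LessThan mult_2)
  then have "(\<Sum>j<2 * n. g x j) = 2 * (\<Sum>j<n. g x j)" for x
    by (simp only: period mult_2)
  then have even: "even (\<Sum>j<2 * n. g x j)" for x
    by (metis dvd_triv_left)
  have "((flip s \<circ> flip t) ^^ n) A
      = {x \<in> carrier W. odd (\<Sum>j<2 * n. g x j) \<noteq> (inv \<one> \<otimes> x \<otimes> \<one> \<in> A)}"
    using flip_flip_pow[OF st(1,2), of A n] \<open>A \<in> _\<close> unfolding g_def pn by (simp only: Pow_iff)
  also have "\<dots> = {x \<in> carrier W. x \<in> A}"
    using even by (intro Collect_cong) auto
  also have "\<dots> = A"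
    using \<open>A \<in> _\<close> by blast
  finally show "((flip s \<circ> flip t) ^^ n) A = A" .
next
  fix s A
  assume "s \<in> S" "A \<in> Pow (carrier W)"
  then show "flip s (flip s A) = A"
    using flip_flip by blast
  show "flip s A \<in> Pow (carrier W)"
    by (auto simp: flip_def)
qed (use assms in simp_all)

text \<open>The left inversions of \<open>w\<close>; by \<open>inversions_cong\<close> the choice of
  the word does not matter.\<close>

definition inv_set :: "'a \<Rightarrow> 'a set" where
  "inv_set w = inversions (SOME xs. set xs \<subseteq> S \<and> word_prod W xs = w)"

lemma inv_set_word_prod:
  assumes "set xs \<subseteq> S"
  shows "inv_set (word_prod W xs) = inversions xs"
  unfolding inv_set_def
proof (rule someI2[where a = xs])
  fix ys
  assume "set ys \<subseteq> S \<and> word_prod W ys = word_prod W xs"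
  then show "inversions ys = inversions xs"
    using assms by (intro inversions_cong) simp_all
qed (use assms in simp)

end

section \<open>Parabolic subgroups\<close>

context coxeter begin

text \<open>For \<open>I \<subseteq> S\<close> this is the standard parabolic subgroup; words
  without inverses suffice since the generators are involutions.\<close>

definition par :: "'a set \<Rightarrow> 'a set" where
  "par I = word_prod W ` lists I"

text \<open>Counting inversions turns statements about lengths of products into statements about
  sets; \<open>word_length_eq\<close> identifies the count with the word length over
  \<open>S\<close>.\<close>

definition len :: "'a \<Rightarrow> nat" where
  "len w = card (inv_set w)"

lemma word_in_par: "set xs \<subseteq> I \<Longrightarrow> word_prod W xs \<in> par I"
  unfolding par_def by auto

lemma parE:
  assumes "w \<in> par I"
  obtains xs where "set xs \<subseteq> I" "word_prod W xs = w"
  using assms unfolding par_def by auto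

lemma par_mono: "I \<subseteq> J \<Longrightarrow> par I \<subseteq> par J"
  unfolding par_def by (intro image_mono lists_mono) blast

lemma one_in_par [simp]: "\<one> \<in> par I"
  using word_in_par[of "[]" I] by simp

lemma gen_in_par: "s \<in> I \<Longrightarrow> I \<subseteq> S \<Longrightarrow> s \<in> par I"
  using word_in_par[of "[s]" I] by auto

lemma par_carrier: "I \<subseteq> S \<Longrightarrow> par I \<subseteq> carrier W"
  using S_carrier by (fastforce elim: parE)

lemma par_mult:
  assumes I: "I \<subseteq> S" and "u \<in> par I" "v \<in> par I"
  shows "u \<otimes> v \<in> par I"
proof -
  obtain xs ys where "set xs \<subseteq> I" "word_prod W xs = u" "set ys \<subseteq> I" "word_prod W ys = v"
    using assms by (metis parE)
  then show ?thesis
    using word_in_par[of "xs @ ys" I] word_prod_append[of xs ys] I S_carrier by auto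
qed

lemma word_prod_rev:
  assumes "set xs \<subseteq> S"
  shows "word_prod W (rev xs) = inv (word_prod W xs)"
  using assms
proof (induction xs)
  case (Cons x xs)
  then have "set xs \<subseteq> carrier W" "x \<in> S"
    using S_carrier by auto
  then show ?case
    using Cons by (simp add: word_prod_append inv_mult_group)
qed simp

lemma par_inv:
  assumes "I \<subseteq> S" "u \<in> par I"
  shows "inv u \<in> par I"
proof -
  obtain xs where xs: "set xs \<subseteq> I" "word_prod W xs = u"
    using assms by (metis parE)
  then have "word_prod W (rev xs) = inv u"
    using word_prod_rev assms by blast
  then show ?thesis
    using word_in_par[of "rev xs" I] xs by simp
qed

lemma par_S: "par S = carrier W"
proof
  have "w \<in> par S" if "w \<in> generate W S" for w
    using that
  proof induction
    case (inv h)
    then show ?case using gen_in_par[of h S] by simp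
  qed (auto intro: gen_in_par par_mult)
  then show "carrier W \<subseteq> par S"
    using coxeter_system unfolding coxeter_system_def by blast
qed (rule par_carrier, simp)

text \<open>Every inversion is a letter conjugated by the prefix before it, and both lie in the
  subgroup generated by \<open>I\<close>.\<close>

lemma inversions_subset:
  assumes I: "I \<subseteq> S"
  shows "set xs \<subseteq> I \<Longrightarrow> inversions xs \<subseteq> par I"
proof (induction xs)
  case (Cons s xs)
  have s: "s \<in> par I" "s \<in> S"
    using Cons.prems I gen_in_par by auto
  have "x \<in> par I" if x: "x \<in> flip s (inversions xs)" for x
  proof (cases "x = s")
    case False
    then have "s \<otimes> x \<otimes> s \<in> par I" "x \<in> carrier W"
      using x Cons unfolding flip_def by auto
    moreover have "s \<otimes> (s \<otimes> x \<otimes> s) \<otimes> s = x"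
      using s(2) \<open>x \<in> carrier W\<close> by (simp add: m_assoc)
    ultimately show ?thesis
      using par_mult[OF I par_mult[OF I s(1)] s(1), of "s \<otimes> x \<otimes> s"] by simp
  qed (use s in simp)
  then show ?case
    by auto
qed simp

lemma inj_on_conj: "u \<in> carrier W \<Longrightarrow> inj_on (\<lambda>x. u \<otimes> x \<otimes> inv u) (carrier W)"
  by (intro inj_onI) simp

lemma flip_insert:
  assumes s: "s \<in> S" and A: "A \<subseteq> carrier W"
  shows "flip s A \<subseteq> insert s ((\<lambda>x. s \<otimes> x \<otimes> s) ` A)"
    and "s \<notin> A \<Longrightarrow> flip s A = insert s ((\<lambda>x. s \<otimes> x \<otimes> s) ` A)"
proof -
  have sq: "s \<otimes> (s \<otimes> x \<otimes> s) \<otimes> s = x" if "x \<in> carrier W" for x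
    using s that by (simp add: m_assoc)
  have img: "x \<in> (\<lambda>x. s \<otimes> x \<otimes> s) ` A \<longleftrightarrow> s \<otimes> x \<otimes> s \<in> A" if x: "x \<in> carrier W" for x
  proof
    assume "s \<otimes> x \<otimes> s \<in> A"
    then show "x \<in> (\<lambda>x. s \<otimes> x \<otimes> s) ` A"
      by (rule rev_image_eqI) (rule sq[OF x, symmetric])
  next
    assume "x \<in> (\<lambda>x. s \<otimes> x \<otimes> s) ` A"
    then obtain y where y: "y \<in> A" "x = s \<otimes> y \<otimes> s"
      by blast
    then have "s \<otimes> x \<otimes> s = y"
      using sq A by blast
    with y show "s \<otimes> x \<otimes> s \<in> A"
      by simp
  qed
  then show "flip s A \<subseteq> insert s ((\<lambda>x. s \<otimes> x \<otimes> s) ` A)"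
    unfolding flip_def by blast
  assume "s \<notin> A"
  moreover have "s \<otimes> s \<otimes> s = s"
    using s by (simp add: m_assoc)
  moreover have "(\<lambda>x. s \<otimes> x \<otimes> s) ` A \<subseteq> carrier W"
    using s A by auto
  ultimately have "x \<in> flip s A \<longleftrightarrow> x \<in> insert s ((\<lambda>x. s \<otimes> x \<otimes> s) ` A)" for x
    using img[of x] S_closed[OF s] unfolding flip_def by (cases "x = s") auto
  then show "flip s A = insert s ((\<lambda>x. s \<otimes> x \<otimes> s) ` A)"
    by blast
qed

lemma card_inversions:
  "set xs \<subseteq> S \<Longrightarrow> finite (inversions xs) \<and> card (inversions xs) \<le> length xs"
proof (induction xs)
  case (Cons s xs)
  let ?C = "(\<lambda>x. s \<otimes> x \<otimes> s) ` inversions xs"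
  have IH: "finite (inversions xs)" "card (inversions xs) \<le> length xs" and s: "s \<in> S"
    using Cons by auto
  have sub: "flip s (inversions xs) \<subseteq> insert s ?C"
    using flip_insert(1)[OF s inversions_carrier] .
  have "card (insert s ?C) \<le> Suc (card (inversions xs))"
    using IH card_image_le[of "inversions xs" "\<lambda>x. s \<otimes> x \<otimes> s"] by (simp add: card_insert_if)
  then have "card (flip s (inversions xs)) \<le> Suc (card (inversions xs))"
    using card_mono[OF _ sub] IH by simp
  then show ?case
    using IH finite_subset[OF sub] by simp
qed simp

text \<open>The strong exchange condition: an inversion is a letter conjugated by the prefix before
  it, so multiplying by it deletes that letter.\<close>

lemma exchange:
  "set xs \<subseteq> S \<Longrightarrow> x \<in> inversions xs
    \<Longrightarrow> \<exists>ys. set ys \<subseteq> set xs \<and> length ys < length xs \<and> word_prod W ys = x \<otimes> word_prod W xs"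
proof (induction xs arbitrary: x)
  case (Cons s xs)
  have s: "s \<in> S" and xs: "set xs \<subseteq> S" and x: "x \<in> carrier W"
    using Cons.prems inversions_carrier[of "s # xs"] by auto
  then have w: "word_prod W xs \<in> carrier W"
    using S_carrier by auto
  show ?case
  proof (cases "x = s")
    case True
    then show ?thesis
      using s w by (intro exI[of _ xs]) auto
  next
    case False
    then have "s \<otimes> x \<otimes> s \<in> inversions xs"
      using Cons.prems by (simp add: flip_def)
    then obtain ys where ys: "set ys \<subseteq> set xs" "length ys < length xs"
      "word_prod W ys = s \<otimes> x \<otimes> s \<otimes> word_prod W xs"
      using Cons.IH xs by blast
    then have "word_prod W (s # ys) = x \<otimes> word_prod W (s # xs)"
      using s x w by (simp add: m_assoc)
    then show ?thesis
      using ys by (intro exI[of _ "s # ys"]) auto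
  qed
qed simp

text \<open>Prepending a letter that is not an inversion of the rest raises the number of inversions
  by exactly one. So if there are too few inversions, some letter is an inversion of the word after
  it, and \<open>exchange\<close> removes it together with a second letter.\<close>

lemma deletion:
  "set xs \<subseteq> S \<Longrightarrow> card (inversions xs) < length xs
    \<Longrightarrow> \<exists>ys. set ys \<subseteq> set xs \<and> length ys < length xs \<and> word_prod W ys = word_prod W xs"
proof (induction xs)
  case (Cons s xs)
  have s: "s \<in> S" and xs: "set xs \<subseteq> S"
    using Cons.prems by auto
  show ?case
  proof (cases "card (inversions xs) < length xs")
    case True
    then obtain ys where "set ys \<subseteq> set xs" "length ys < length xs" "word_prod W ys = word_prod W xs"
      using Cons.IH xs by blast
    then show ?thesis
      by (intro exI[of _ "s # ys"]) auto
  next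
    case False
    then have card: "card (inversions xs) = length xs"
      using card_inversions[OF xs] by simp
    have "s \<in> inversions xs"
    proof (rule ccontr)
      let ?C = "(\<lambda>x. s \<otimes> x \<otimes> s) ` inversions xs"
      assume "s \<notin> inversions xs"
      then have eq: "inversions (s # xs) = insert s ?C" "s \<notin> ?C"
        using flip_insert(2)[OF s inversions_carrier] s conj_eq_iff[OF s, of _ s] inversions_carrier[of xs]
        by (auto simp: m_assoc subset_iff)
      have "card ?C = card (inversions xs)"
        using inj_on_subset[OF inj_on_conj[of s] inversions_carrier] s by (intro card_image) simp
      then have "card (inversions (s # xs)) = Suc (length xs)"
        unfolding eq using eq(2) card_inversions[OF xs] card by simp
      then show False
        using Cons.prems by simp
    qed
    then obtain ys where "set ys \<subseteq> set xs" "length ys < length xs" "word_prod W ys = s \<otimes> word_prod W xs"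
      using exchange[OF xs] by blast
    then show ?thesis
      by (intro exI[of _ ys]) auto
  qed
qed simp

section \<open>Length as the number of inversions\<close>

lemma inv_set_props:
  assumes I: "I \<subseteq> S" and w: "w \<in> par I"
  shows inv_set_par: "inv_set w \<subseteq> par I" and finite_inv_set: "finite (inv_set w)"
proof -
  obtain xs where xs: "set xs \<subseteq> I" "word_prod W xs = w"
    using w by (rule parE)
  then have eq: "inv_set w = inversions xs"
    using inv_set_word_prod[of xs] I by auto
  show "inv_set w \<subseteq> par I"
    unfolding eq using inversions_subset[OF I xs(1)] .
  show "finite (inv_set w)"
    unfolding eq using card_inversions[of xs] xs(1) I by auto
qed

lemma len_word_prod: "set xs \<subseteq> S \<Longrightarrow> len (word_prod W xs) \<le> length xs"
  using card_inversions by (simp add: len_def inv_set_word_prod)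

text \<open>The number of inversions does not depend on \<open>I\<close>, so parabolic subgroups are isometrically
  embedded.\<close>

lemma reduced_word:
  assumes I: "I \<subseteq> S" and w: "w \<in> par I"
  obtains xs where "set xs \<subseteq> I" "word_prod W xs = w" "length xs = len w"
proof -
  obtain xs where xs: "set xs \<subseteq> I" "word_prod W xs = w"
    and least: "\<And>ys. set ys \<subseteq> I \<Longrightarrow> word_prod W ys = w \<Longrightarrow> length xs \<le> length ys"
    using w ex_has_least_nat[of "\<lambda>xs. set xs \<subseteq> I \<and> word_prod W xs = w" _ length]
    by (metis parE)
  have S: "set xs \<subseteq> S"
    using xs I by auto
  have "\<not> card (inversions xs) < length xs"
    using deletion[OF S] least xs by (meson leD subset_trans)
  then have "length xs = len w"
    using card_inversions[OF S] inv_set_word_prod[OF S] xs by (simp add: len_def)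
  with xs show ?thesis
    using that by blast
qed

lemma reduced_word_S:
  assumes "w \<in> carrier W"
  obtains xs where "set xs \<subseteq> S" "word_prod W xs = w" "length xs = len w"
  using reduced_word[of S w] assms unfolding par_S by blast

lemma word_length_eq:
  assumes "w \<in> carrier W"
  shows "word_length W S w = len w"
proof -
  obtain xs where xs: "set xs \<subseteq> S" "word_prod W xs = w" "length xs = len w"
    using assms by (rule reduced_word_S)
  have "(\<lambda>s. inv s) ` S = S"
    by simp
  then have "word_length W S w = (LEAST n. \<exists>xs. length xs = n \<and> set xs \<subseteq> S \<and> w = word_prod W xs)"
    unfolding word_length_def by simp
  also have "\<dots> = len w"
  proof (rule Least_equality)
    show "\<exists>xs. length xs = len w \<and> set xs \<subseteq> S \<and> w = word_prod W xs"
      using xs by blast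
  next
    fix n
    assume "\<exists>xs. length xs = n \<and> set xs \<subseteq> S \<and> w = word_prod W xs"
    then show "len w \<le> n"
      using len_word_prod by blast
  qed
  finally show ?thesis .
qed

lemma len_one_gen:
  assumes "s \<in> S"
  shows "len s = 1"
proof -
  have "inv_set s = inversions [s]"
    using inv_set_word_prod[of "[s]"] assms by simp
  also have "\<dots> = {s}"
    using assms by (auto simp: flip_def)
  finally show ?thesis
    by (simp add: len_def)
qed

lemma len_one [simp]: "len \<one> = 0"
  using len_word_prod[of "[]"] by simp

lemma len_eq_0:
  assumes "w \<in> carrier W" "len w = 0"
  shows "w = \<one>"
  by (rule reduced_word_S[OF assms(1)]) (use assms(2) in auto)

lemma inv_set_less:
  assumes w: "w \<in> carrier W" and x: "x \<in> inv_set w"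
  shows "len (x \<otimes> w) < len w"
proof -
  obtain xs where xs: "set xs \<subseteq> S" "word_prod W xs = w" "length xs = len w"
    using w by (rule reduced_word_S)
  then obtain ys where ys: "set ys \<subseteq> S" "length ys < length xs" "word_prod W ys = x \<otimes> w"
    using exchange[OF xs(1), of x] x inv_set_word_prod[OF xs(1)] by (metis subset_trans)
  then show ?thesis
    using len_word_prod[OF ys(1)] xs by simp
qed

lemma one_notin_inv_set: "w \<in> carrier W \<Longrightarrow> \<one> \<notin> inv_set w"
  using inv_set_less[of w \<one>] by auto

section \<open>Inversions of products and additivity of length\<close>

lemma inversions_append:
  "set xs \<subseteq> S \<Longrightarrow> x \<in> carrier W \<Longrightarrow> x \<in> inversions (xs @ ys) \<longleftrightarrow>
    (x \<in> inversions xs) \<noteq> (inv (word_prod W xs) \<otimes> x \<otimes> word_prod W xs \<in> inversions ys)"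
proof (induction xs arbitrary: x)
  case (Cons s xs)
  have s: "s \<in> S" and xs: "set xs \<subseteq> S"
    using Cons.prems by auto
  then have w: "word_prod W xs \<in> carrier W"
    using S_carrier by auto
  have "inv (word_prod W xs) \<otimes> (s \<otimes> x \<otimes> s) \<otimes> word_prod W xs
      = inv (word_prod W (s # xs)) \<otimes> x \<otimes> word_prod W (s # xs)"
    using s w Cons.prems by (simp add: inv_mult_group m_assoc)
  then show ?case
    using Cons.IH[OF xs, of "s \<otimes> x \<otimes> s"] Cons.prems by (auto simp: flip_def)
qed simp

text \<open>The cocycle identity N(uw) = N(u) + u N(w) u^-1 of inversion sets, where + is the
  symmetric difference; it is read off from a concatenation of words.\<close>

lemma inv_set_mult:
  assumes u: "u \<in> carrier W" and w: "w \<in> carrier W" and x: "x \<in> carrier W"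
  shows "x \<in> inv_set (u \<otimes> w) \<longleftrightarrow> (x \<in> inv_set u) \<noteq> (inv u \<otimes> x \<otimes> u \<in> inv_set w)"
proof -
  obtain xs ys where xs: "set xs \<subseteq> S" "word_prod W xs = u" and ys: "set ys \<subseteq> S" "word_prod W ys = w"
    using u w par_S by (metis parE)
  have "word_prod W (xs @ ys) = u \<otimes> w"
    using xs ys S_carrier by (subst word_prod_append) auto
  then have "inv_set (u \<otimes> w) = inversions (xs @ ys)"
    using inv_set_word_prod[of "xs @ ys"] xs ys by simp
  then show ?thesis
    using inversions_append[OF xs(1) x, of ys] inv_set_word_prod xs ys by auto
qed

text \<open>The inversions of \<open>u\<close> lie in \<open>par I\<close>, while those of
  \<open>h\<close>, conjugated by \<open>u\<close>, stay outside it. So nothing cancels in the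
  cocycle identity, and the cardinalities add.\<close>

lemma len_mult_disjoint:
  assumes I: "I \<subseteq> S" and u: "u \<in> par I" and h: "h \<in> carrier W"
    and disj: "inv_set h \<inter> par I = {}"
  shows "len (u \<otimes> h) = len u + len h"
proof -
  let ?c = "\<lambda>x. u \<otimes> x \<otimes> inv u"
  have uc: "u \<in> carrier W"
    using u par_carrier I by auto
  have fin: "finite (inv_set u)" "finite (inv_set h)"
    using finite_inv_set[of S] uc h par_S by auto
  have inv_carrier: "inv_set w \<subseteq> carrier W" if "w \<in> carrier W" for w
    using inv_set_par[of S w] that par_S by simp
  have notin: "?c y \<notin> par I" if "y \<in> inv_set h" for y
  proof
    assume "?c y \<in> par I"
    then have "inv u \<otimes> ?c y \<otimes> u \<in> par I"
      by (rule par_mult[OF I par_mult[OF I par_inv[OF I u]] u])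
    moreover have "y \<in> carrier W"
      using that inv_carrier h by auto
    ultimately show False
      using that disj uc by (auto simp: m_assoc inv_cancel_left)
  qed
  have conv: "inv u \<otimes> x \<otimes> u \<in> inv_set h \<longleftrightarrow> x \<in> ?c ` inv_set h" if "x \<in> carrier W" for x
  proof
    assume y: "inv u \<otimes> x \<otimes> u \<in> inv_set h"
    then have "x = ?c (inv u \<otimes> x \<otimes> u)"
      using that uc inv_conj_eq_iff[OF uc that, of "inv u \<otimes> x \<otimes> u"] by simp
    with y show "x \<in> ?c ` inv_set h"
      by (rule rev_image_eqI)
  next
    assume "x \<in> ?c ` inv_set h"
    then obtain y where y: "y \<in> inv_set h" "x = ?c y"
      by blast
    then have "inv u \<otimes> x \<otimes> u = y"
      using inv_conj_eq_iff[OF uc that, of y] inv_carrier[OF h] by auto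
    with y show "inv u \<otimes> x \<otimes> u \<in> inv_set h"
      by simp
  qed
  have "x \<in> inv_set (u \<otimes> h) \<longleftrightarrow> x \<in> inv_set u \<union> ?c ` inv_set h" if "x \<in> carrier W" for x
    using inv_set_mult[OF uc h that] conv[OF that] notin inv_set_par[OF I u] by blast
  moreover have "?c ` inv_set h \<subseteq> carrier W" "inv_set u \<subseteq> carrier W" "inv_set (u \<otimes> h) \<subseteq> carrier W"
    using inv_carrier uc h by (auto simp: subset_iff)
  ultimately have "inv_set (u \<otimes> h) = inv_set u \<union> ?c ` inv_set h"
    by blast
  moreover have "inv_set u \<inter> ?c ` inv_set h = {}"
    using notin inv_set_par[OF I u] by blast
  moreover have "card (?c ` inv_set h) = card (inv_set h)"
    by (intro card_image inj_on_subset[OF inj_on_conj[OF uc] inv_carrier[OF h]])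
  ultimately show ?thesis
    unfolding len_def using fin by (simp add: card_Un_disjoint)
qed

text \<open>An inversion of \<open>h\<close> in \<open>par I\<close> would give a shorter element of
  the same coset, so \<open>h\<close> has none there.\<close>

lemma len_mult_coset_min:
  assumes I: "I \<subseteq> S" and u: "u \<in> par I" and h: "h \<in> carrier W"
    and min: "\<And>v. v \<in> par I \<Longrightarrow> len h \<le> len (v \<otimes> h)"
  shows "len (u \<otimes> h) = len u + len h"
  using I u h
proof (rule len_mult_disjoint)
  show "inv_set h \<inter> par I = {}"
    using inv_set_less[OF h] min by (meson disjoint_iff leD)
qed

text \<open>The first letter of a nonempty reduced word over \<open>J\<close> for a common element
  is an inversion of it, hence lies in \<open>par I\<close>. Being of length one, it is a letter of
  \<open>I\<close>, which contradicts disjointness.\<close>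

lemma par_Int:
  assumes I: "I \<subseteq> S" and J: "J \<subseteq> S" and IJ: "I \<inter> J = {}"
  shows "par I \<inter> par J = {\<one>}"
proof -
  have "w = \<one>" if wI: "w \<in> par I" and wJ: "w \<in> par J" for w
  proof -
    obtain xs where xs: "set xs \<subseteq> J" "word_prod W xs = w" "length xs = len w"
      using J wJ by (rule reduced_word)
    show ?thesis
    proof (cases xs)
      case Nil
      then show ?thesis
        using xs by simp
    next
      case (Cons s ys)
      have s: "s \<in> J" "s \<in> S" and ys: "set ys \<subseteq> S" and xsS: "set xs \<subseteq> S"
        using xs J Cons by auto
      have "s \<notin> inversions ys"
      proof
        assume "s \<in> inversions ys"
        then obtain zs where "set zs \<subseteq> S" "length zs < length ys" "word_prod W zs = w"
          using exchange[OF ys] ys xs Cons by (metis subset_trans word_prod_Cons)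
        then show False
          using len_word_prod[of zs] xs Cons by simp
      qed
      then have "s \<in> inversions xs"
        using s by (simp add: Cons flip_def m_assoc)
      then have "s \<in> par I"
        using inv_set_par[OF I wI] inv_set_word_prod[OF xsS] xs by auto
      then obtain us where us: "set us \<subseteq> I" "word_prod W us = s" "length us = 1"
        using reduced_word[OF I] len_one_gen[OF s(2)] by metis
      then obtain t where "us = [t]"
        by (metis One_nat_def length_0_conv length_Suc_conv)
      then have "s \<in> I"
        using us I by auto
      then show ?thesis
        using s IJ by auto
    qed
  qed
  then show ?thesis
    by auto
qed

end

section \<open>The length-decreasing bijection of the dihedral group\<close>

locale dihedral = group G for G (structure) +
  fixes a b :: 'a and k :: nat
  assumes a [simp]: "a \<in> carrier G" and b [simp]: "b \<in> carrier G"
    and aa: "a \<otimes> a = \<one>" and bb: "b \<otimes> b = \<one>"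
    and ord_ba: "ord (b \<otimes> a) = 2 * (2 * k + 1)" and k: "k \<ge> 1"
begin

definition rot :: "int \<Rightarrow> 'a" where
  "rot i = (b \<otimes> a) [^] i"

text \<open>The normal form of dihedral elements: rotations for \<open>e\<close> false, reflections
  for \<open>e\<close> true. The exponent is any integer and is determined modulo
  \<open>period\<close>.\<close>

definition elt :: "bool \<Rightarrow> int \<Rightarrow> 'a" where
  "elt e i = (if e then a \<otimes> rot i else rot i)"

definition period :: int where
  "period = 2 * (2 * int k + 1)"

lemma rot_closed [simp]: "rot i \<in> carrier G"
  by (simp add: rot_def)

lemma elt_closed [simp]: "elt e i \<in> carrier G"
  by (simp add: elt_def)

lemma rot_add: "rot (i + j) = rot i \<otimes> rot j"
  by (simp add: rot_def int_pow_mult)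

lemma rot_0 [simp]: "rot 0 = \<one>"
  by (simp add: rot_def)

lemma inv_a [simp]: "inv a = a" and inv_b [simp]: "inv b = b"
  using aa bb by (auto intro: inv_equality)

lemma a_left: "x \<in> carrier G \<Longrightarrow> a \<otimes> (a \<otimes> x) = x"
  using aa by (simp flip: m_assoc)

lemma conj_rot: "a \<otimes> rot i \<otimes> a = rot (- i)"
proof -
  have "(\<lambda>x. a \<otimes> x \<otimes> a) \<in> hom G G"
    by (intro homI) (simp_all add: m_assoc a_left)
  then have "a \<otimes> rot i \<otimes> a = (a \<otimes> (b \<otimes> a) \<otimes> a) [^] i"
    unfolding rot_def using hom_int_pow[of "\<lambda>x. a \<otimes> x \<otimes> a" G G "b \<otimes> a" i] is_group by simp
  also have "a \<otimes> (b \<otimes> a) \<otimes> a = inv (b \<otimes> a)"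
    by (simp add: inv_mult_group m_assoc aa)
  finally show ?thesis
    by (simp add: rot_def int_pow_inv int_pow_neg)
qed

lemma rot_a: "rot i \<otimes> a = a \<otimes> rot (- i)"
  unfolding conj_rot[symmetric] by (simp add: m_assoc a_left)

lemma b_eq: "b = rot 1 \<otimes> a"
  by (simp add: rot_def m_assoc aa)

lemma rot_eq_one: "rot i = \<one> \<longleftrightarrow> period dvd i"
  using int_pow_eq_id[of "b \<otimes> a" i] unfolding rot_def ord_ba period_def by (simp add: algebra_simps)

lemma rot_eq: "rot i = rot j \<longleftrightarrow> period dvd i - j"
proof -
  have "rot i = rot j \<longleftrightarrow> rot (i - j) \<otimes> rot j = rot j"
    by (simp flip: rot_add)
  then show ?thesis
    by (simp add: rot_eq_one)
qed

text \<open>A power of \<open>b \<otimes> a\<close> commutes with \<open>b \<otimes> a\<close>,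
  whereas conjugation by \<open>a\<close> inverts it. The rotation would then have order dividing 2,
  but \<open>period\<close> is at least 6.\<close>

lemma a_neq_rot: "a \<noteq> rot i"
proof
  assume "a = rot i"
  then have "rot 1 \<otimes> a = a \<otimes> rot 1"
    using rot_add[of i 1] rot_add[of 1 i] by (simp add: add.commute)
  then have "a \<otimes> rot 1 \<otimes> a = rot 1 \<otimes> (a \<otimes> a)"
    by (metis a m_assoc rot_closed)
  then have "rot (- 1) = rot 1"
    unfolding conj_rot by (simp add: aa)
  then have "period dvd 2"
    unfolding rot_eq by simp
  then show False
    using k zdvd_imp_le[of period 2] by (simp add: period_def)
qed

lemma elt_eq: "elt e i = elt e' j \<longleftrightarrow> e = e' \<and> period dvd i - j"
proof -
  have neq: "a \<otimes> rot i \<noteq> rot j" for i j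
  proof
    assume "a \<otimes> rot i = rot j"
    then have "a = rot (j - i)"
      using rot_add[of "j - i" i] by (simp add: r_cancel)
    then show False
      using a_neq_rot by blast
  qed
  show ?thesis
    using neq[of i j] neq[of j i] by (cases e; cases e') (auto simp: elt_def rot_eq)
qed

lemma a_elt: "a \<otimes> elt e i = elt (\<not> e) i"
  by (simp add: elt_def a_left)

lemma rot_elt: "rot j \<otimes> elt e i = elt e (if e then i - j else i + j)"
proof (cases e)
  case True
  have "rot j \<otimes> (a \<otimes> rot i) = rot j \<otimes> a \<otimes> rot i"
    by (simp add: m_assoc)
  also have "\<dots> = a \<otimes> rot (i - j)"
    using rot_add[of "- j" i] by (simp add: rot_a m_assoc)
  finally show ?thesis
    using True by (simp add: elt_def)
next
  case False
  then show ?thesis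
    using rot_add[of j i] by (simp add: elt_def add.commute)
qed

lemma rot_a_elt: "rot j \<otimes> a \<otimes> elt e i = elt (\<not> e) (if e then i + j else i - j)"
  by (simp add: m_assoc a_elt rot_elt)

lemma b_elt: "b \<otimes> elt e i = elt (\<not> e) (if e then i + 1 else i - 1)"
  using rot_a_elt[of 1 e i] by (simp flip: b_eq)

lemma c_eq: "b \<otimes> a \<otimes> b = rot 2 \<otimes> a"
proof -
  have "b \<otimes> a \<otimes> b = rot 1 \<otimes> b"
    by (simp add: rot_def)
  also have "\<dots> = rot 1 \<otimes> (rot 1 \<otimes> a)"
    by (simp only: b_eq[symmetric])
  also have "\<dots> = rot 2 \<otimes> a"
    using rot_add[of 1 1] by (simp add: m_assoc)
  finally show ?thesis .
qed

section \<open>The letters \<open>c\<close> and \<open>r\<close>, and lengths in the dihedral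
  group\<close>

definition c :: 'a where "c = b \<otimes> a \<otimes> b"

definition r :: 'a where "r = (b \<otimes> a) [^] (2 * k + 1)"

lemma c_elt: "c \<otimes> elt e i = elt (\<not> e) (if e then i + 2 else i - 2)"
  unfolding c_def c_eq by (rule rot_a_elt)

lemma r_elt: "r \<otimes> elt e i = elt e (i + (2 * int k + 1))"
proof -
  have "r = rot (2 * int k + 1)"
    unfolding rot_def r_def int_pow_int[symmetric] by (simp add: algebra_simps)
  \<comment> \<open>\<open>r\<close> is the rotation by half a period, so adding and subtracting its
    exponent agree and the case distinction of \<open>rot_elt\<close> disappears.\<close>
  moreover have "period dvd (i - (2 * int k + 1)) - (i + (2 * int k + 1))"
    by (rule dvdI[of _ _ "- 1"]) (simp add: period_def)
  ultimately show ?thesis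
    unfolding rot_elt elt_eq by (cases e) (simp_all only: rot_elt elt_eq if_True if_False diff_self dvd_0_right simp_thms)
qed

text \<open>Left multiplication by either letter changes \<open>2 * i + of_bool e\<close> by exactly
  one.\<close>

lemma word_ab:
  "set xs \<subseteq> {a, b} \<Longrightarrow> \<exists>e i. word_prod G xs = elt e i \<and> \<bar>2 * i + of_bool e\<bar> \<le> int (length xs)"
proof (induction xs)
  case Nil
  show ?case
    by (intro exI[of _ False] exI[of _ 0]) (simp add: elt_def)
next
  case (Cons x xs)
  then obtain e i where IH: "word_prod G xs = elt e i" "\<bar>2 * i + of_bool e\<bar> \<le> int (length xs)"
    by auto
  consider "x = a" | "x = b"
    using Cons.prems by auto
  then show ?case
  proof cases
    case 1
    then show ?thesis
      using IH by (intro exI[of _ "\<not> e"] exI[of _ i]) (cases e; simp add: a_elt)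
  next
    case 2
    then show ?thesis
      using IH by (intro exI[of _ "\<not> e"] exI[of _ "if e then i + 1 else i - 1"]) (cases e; simp add: b_elt)
  qed
qed

text \<open>Both \<open>a\<close> and \<open>c\<close> change \<open>j + of_bool e\<close> by one
  and keep \<open>j\<close> even, and as long as this number is nonzero one of them moves it towards
  0.\<close>

lemma word_ac:
  assumes "even j"
  shows "\<exists>ys. set ys \<subseteq> {a, c} \<and> word_prod G ys = elt e j \<and> int (length ys) = \<bar>j + of_bool e\<bar>"
  using assms
proof (induction "nat \<bar>j + of_bool e\<bar>" arbitrary: e j)
  case 0
  then have "j = - of_bool e" "even j"
    by simp_all
  then have "\<not> e \<and> j = 0"
    by (cases e) simp_all
  then show ?case
    by (intro exI[of _ "[]"]) (simp add: elt_def)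
next
  case (Suc n)
  have step: ?case
    if j': "n = nat \<bar>j' + of_bool (\<not> e)\<bar>" "even j'"
      and x: "x \<in> {a, c}" "x \<otimes> elt (\<not> e) j' = elt e j" for x j'
  proof -
    obtain ys where "set ys \<subseteq> {a, c}" "word_prod G ys = elt (\<not> e) j'" "int (length ys) = int n"
      using Suc.hyps(1)[OF j'] j'(1) by auto
    then show ?thesis
      using x Suc.hyps(2) by (intro exI[of _ "x # ys"]) auto
  qed
  show ?case
  proof (cases e; cases "j \<ge> 0")
    assume "e" "j \<ge> 0"
    then show ?case
      using Suc by (intro step[of j a]) (auto simp: a_elt)
  next
    assume "e" "\<not> j \<ge> 0"
    then show ?case
      using Suc by (intro step[of "j + 2" c]) (auto simp: c_elt)
  next
    assume "\<not> e" "j \<ge> 0"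
    then show ?case
      using Suc by (intro step[of "j - 2" c]) (auto simp: c_elt)
  next
    assume "\<not> e" "\<not> j \<ge> 0"
    then show ?case
      using Suc by (intro step[of j a]) (auto simp: a_elt)
  qed
qed

lemma word_acr:
  assumes "even j"
  shows "\<exists>ys. set ys \<subseteq> {a, c, r} \<and> word_prod G ys = elt e (j + (2 * int k + 1))
    \<and> int (length ys) = \<bar>j + of_bool e\<bar> + 1"
proof -
  obtain ys where "set ys \<subseteq> {a, c}" "word_prod G ys = elt e j" "int (length ys) = \<bar>j + of_bool e\<bar>"
    using word_ac[OF assms] by blast
  then show ?thesis
    by (intro exI[of _ "r # ys"]) (auto simp: r_elt)
qed

text \<open>The rotations \<open>\<rho>\<^sup>i\<close> are normalised to \<open>-2k \<le> i \<le> 2k + 1\<close>. In the letters \<open>a, b\<close> the element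
  \<open>a\<^sup>e \<rho>\<^sup>i\<close> needs at least \<open>\<bar>2i + e\<bar>\<close> letters (for the best choice of \<open>i\<close> modulo the period); in the
  letters \<open>a, c, r\<close> it suffices to use \<open>\<bar>j + e\<bar>\<close> letters for \<open>i = j\<close> and \<open>\<bar>j + e\<bar> + 1\<close> letters for
  \<open>i = j + 2k + 1\<close>, where \<open>j\<close> is even. The following permutation of the exponents matches these
  lengths: an odd exponent moves to the next even one away from \<open>0\<close>, and an even exponent \<open>j\<close> to
  \<open>j + 2k + 1\<close>, except that \<open>0\<close> and \<open>2k + 1\<close> are fixed.\<close>

definition red :: "int \<Rightarrow> int" where
  "red i = (i + 2 * int k) mod period - 2 * int k"

definition shift :: "int \<Rightarrow> int" where
  "shift i = (if i = 0 \<or> i = 2 * int k + 1 then i else if odd i then i + sgn i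
     else if i > 0 then i - (2 * int k + 1) else i + (2 * int k + 1))"

lemma red_range: "red i \<in> {- 2 * int k..2 * int k + 1}"
proof -
  have "period > 0"
    by (simp add: period_def)
  then have "0 \<le> (i + 2 * int k) mod period" "(i + 2 * int k) mod period < 4 * int k + 2"
    using pos_mod_bound[of period "i + 2 * int k"] by (simp_all add: period_def)
  then show ?thesis
    unfolding red_def by simp
qed

lemma red_cong: "period dvd i - red i"
  unfolding red_def by (simp add: algebra_simps flip: minus_mod_eq_mult_div)

lemma red_eq: "red i = red j \<longleftrightarrow> period dvd i - j"
  unfolding red_def by (simp add: mod_eq_dvd_iff)

lemma shift_range:
  assumes "i \<in> {- 2 * int k..2 * int k + 1}"
  shows "shift i \<in> {- 2 * int k..2 * int k + 1}"
proof -
  have "odd i \<longrightarrow> i \<noteq> - 2 * int k"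
    by auto
  then show ?thesis
    using assms unfolding shift_def sgn_if by auto
qed

lemma shift_inj: "inj_on shift {- 2 * int k..2 * int k + 1}"
proof (rule inj_on_inverseI)
  define h where "h = 2 * int k + 1"
  \<comment> \<open>The inverse map. \<open>shift\<close> changes the parity except at the fixed
    exponents \<open>0\<close> and \<open>h\<close>, so the parity of the image tells which rule was
    applied, and its sign tells the direction.\<close>
  let ?g = "\<lambda>x. if x = 0 \<or> x = h then x else if even x then x - sgn x else if x < 0 then x + h else x - h"
  fix i
  assume "i \<in> {- 2 * int k..2 * int k + 1}"
  then have i: "1 - h \<le> i" "i \<le> h" and h: "odd h"
    by (simp_all add: h_def)
  have shift: "shift i = (if i = 0 \<or> i = h then i else if odd i then i + sgn i
      else if i > 0 then i - h else i + h)"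
    by (simp add: shift_def h_def)
  consider "i = 0 \<or> i = h" | "odd i" "i \<noteq> h" | "even i" "i > 0" | "even i" "i < 0"
    by linarith
  then show "?g (shift i) = i"
  proof cases
    case 1
    then show ?thesis
      by (auto simp: shift)
  next
    case 2
    then have "shift i = i + sgn i" "even (shift i)" "i \<noteq> 0"
      by (auto simp: shift sgn_if)
    moreover have "shift i \<noteq> 0 \<and> shift i \<noteq> h"
      using calculation h i 2 by (auto simp: sgn_if split: if_splits)
    ultimately show ?thesis
      by (auto simp: sgn_if split: if_splits)
  next
    case 3
    then have "shift i = i - h" "odd (shift i)" "shift i < 0"
      using h i by (auto simp: shift)
    then show ?thesis
      using i by auto
  next
    case 4
    then have "shift i = i + h" "odd (shift i)" "shift i > 0"
      using h i by (auto simp: shift)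
    then show ?thesis
      using 4 by auto
  qed
qed

text \<open>Both values lie in a window of \<open>period\<close> consecutive integers, where
  congruence means equality and \<open>shift\<close> is injective.\<close>

lemma shift_eq:
  assumes "period dvd shift (red i) - shift (red j)"
  shows "red i = red j"
proof -
  have "shift (red i) = shift (red j)"
  proof (rule ccontr)
    assume "shift (red i) \<noteq> shift (red j)"
    then have "period \<le> \<bar>shift (red i) - shift (red j)\<bar>"
      using zdvd_imp_le[of period "\<bar>shift (red i) - shift (red j)\<bar>"] assms by simp
    moreover have "\<bar>x - y\<bar> < period"
      if "x \<in> {- 2 * int k..2 * int k + 1}" "y \<in> {- 2 * int k..2 * int k + 1}" for x y
      using that by (simp add: period_def abs_less_iff)
    from this[OF shift_range[OF red_range] shift_range[OF red_range]]
    have "\<bar>shift (red i) - shift (red j)\<bar> < period" .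
    ultimately show False
      by simp
  qed
  then show ?thesis
    using inj_onD[OF shift_inj _ red_range red_range] by blast
qed

text \<open>The length comparison behind the permutation of exponents: \<open>word_ab\<close>
  supplies the hypothesis, with \<open>n\<close> the length of a word in \<open>a\<close> and
  \<open>b\<close>.\<close>

lemma word_shift:
  assumes "\<bar>2 * i + of_bool e\<bar> \<le> n"
  shows "\<exists>ys. set ys \<subseteq> {a, c, r} \<and> int (length ys) \<le> n \<and> word_prod G ys = elt e (shift (red i))"
proof -
  define j where "j = red i"
  define h where "h = 2 * int k + 1"
  have j: "- 2 * int k \<le> j" "j \<le> 2 * int k + 1"
    using red_range[of i] by (simp_all add: j_def)
  obtain q where q: "i = j + 2 * h * q"
    using red_cong[of i] unfolding dvd_def period_def j_def h_def by (metis add.commute diff_add_cancel)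
  \<comment> \<open>An exponent outside the window differs from \<open>j\<close> by a nonzero
    multiple of \<open>2 * h\<close>. The worst case is \<open>j = h\<close>, \<open>q = -1\<close>
    with \<open>e\<close> true.\<close>
  have big: "2 * h - 1 \<le> \<bar>2 * i + of_bool e\<bar>" if "q \<noteq> 0"
  proof -
    define Q where "Q = 2 * h * q"
    have "Q \<ge> 2 * h \<or> Q \<le> - (2 * h)"
    proof (cases "q > 0")
      case True
      then show ?thesis
        using mult_left_mono[of 1 q "2 * h"] by (simp add: h_def Q_def)
    next
      case False
      then show ?thesis
        using mult_left_mono[of q "-1" "2 * h"] that by (simp add: h_def Q_def)
    qed
    moreover have jh: "j \<le> h" "1 - h \<le> j"
      using j by (simp_all add: h_def)
    ultimately have "2 * h - 1 \<le> \<bar>2 * (j + Q) + E\<bar>" if E: "0 \<le> E" "E \<le> 1" for E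
    proof (elim disjE)
      assume "2 * h \<le> Q"
      then have "2 * h - 1 \<le> 2 * (j + Q) + E"
        using jh E by arith
      then show ?thesis
        by (rule order_trans) (rule abs_ge_self)
    next
      assume "Q \<le> - (2 * h)"
      then have "2 * h - 1 \<le> - (2 * (j + Q) + E)"
        using jh E by arith
      then show ?thesis
        by (rule order_trans) (rule abs_ge_minus_self)
    qed
    from this[of "of_bool e"] show ?thesis
      by (simp add: q Q_def)
  qed
  \<comment> \<open>For \<open>q \<noteq> 0\<close> the previous bound gives
    \<open>2 * h - 1 = 4 * k + 1\<close> letters, which is at least \<open>2 * k + 2\<close> because
    \<open>k \<ge> 1\<close>.\<close>
  have bound: "l \<le> n" if "l \<le> \<bar>2 * j + of_bool e\<bar>" "l \<le> 2 * int k + 2" for l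
    using that assms big k by (cases "q = 0") (auto simp: q h_def)
  have A: ?thesis if "even x" "shift j = x" "\<bar>x + of_bool e\<bar> \<le> n" for x
    using word_ac[OF that(1), of e] that(2,3) unfolding j_def by fastforce
  have B: ?thesis if "even x" "period dvd x + h - shift j" "\<bar>x + of_bool e\<bar> + 1 \<le> n" for x
  proof -
    have "elt e (x + h) = elt e (shift j)"
      using that(2) by (simp add: elt_eq)
    then show ?thesis
      using word_acr[OF that(1), of e] that(3) unfolding j_def h_def by fastforce
  qed
  \<comment> \<open>The cases of \<open>shift\<close>: \<open>0\<close> and the odd exponents other
    than \<open>h\<close> have even images, reached by \<open>a\<close> and \<open>c\<close> alone;
    the images of \<open>h\<close> and of the nonzero even exponents take one letter
    \<open>r\<close>.\<close>
  consider "j = 0" | "j = h" | "odd j" "j \<noteq> h" | "even j" "j \<noteq> 0"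
    by blast
  then show ?thesis
  proof cases
    case 1
    then show ?thesis
      by (intro A[of 0] bound) (auto simp: shift_def)
  next
    case 2
    then show ?thesis
      by (intro B[of 0] bound) (auto simp: shift_def h_def)
  next
    case 3
    then show ?thesis
      using j by (intro A[of "j + sgn j"] bound) (auto simp: shift_def h_def sgn_if)
  next
    case 4
    then have "period dvd j + h - shift j"
      by (auto simp: shift_def h_def period_def)
    moreover obtain l where l: "j = 2 * l" "l \<noteq> 0" "- int k \<le> l" "l \<le> int k"
      using 4 j by (auto elim!: evenE)
    have "\<bar>j + of_bool e\<bar> + 1 \<le> \<bar>2 * j + of_bool e\<bar>" "\<bar>j + of_bool e\<bar> + 1 \<le> 2 * int k + 2"
      using l by auto
    ultimately show ?thesis
      using 4 by (intro B[of j] bound)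
  qed
qed

text \<open>The bijection \<open>f\<close>. Any normal form may be chosen: the exponent is
  determined modulo \<open>period\<close>, and \<open>red\<close> sees only this residue.\<close>

definition twist :: "'a \<Rightarrow> 'a" where
  "twist d = (case SOME (e, i). d = elt e i of (e, i) \<Rightarrow> elt e (shift (red i)))"

lemma twist_elt: "twist (elt e i) = elt e (shift (red i))"
proof -
  obtain e' i' where eq: "(SOME (e', i'). elt e i = elt e' i') = (e', i')"
    by fastforce
  then have "elt e i = elt e' i'"
    using someI[of "\<lambda>(e', i'). elt e i = elt e' i'" "(e, i)"] by simp
  then show ?thesis
    unfolding twist_def eq by (simp add: elt_eq flip: red_eq)
qed

lemma dihedral_elts: "word_prod G ` lists {a, b} = {elt e i | e i. True}"
proof
  show "word_prod G ` lists {a, b} \<subseteq> {elt e i | e i. True}"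
    using word_ab by fastforce
  have "elt e i \<in> word_prod G ` lists {a, b}" for e i
  proof -
    have cl: "x \<otimes> y \<in> word_prod G ` lists {a, b}"
      if x: "x \<in> {a, b}" and y: "y \<in> word_prod G ` lists {a, b}" for x y
    proof -
      obtain ys where "set ys \<subseteq> {a, b}" "y = word_prod G ys"
        using y by auto
      then show ?thesis
        using x by (intro image_eqI[of _ _ "x # ys"]) auto
    qed
    have "elt False i \<in> word_prod G ` lists {a, b}"
    proof (induction i rule: int_induct[of _ 0])
      case base
      then show ?case
        by (intro image_eqI[of _ _ "[]"]) (simp_all add: elt_def)
    next
      case (step1 i)
      then show ?case
        using cl[OF _ cl[of a "elt False i"], of b] by (simp add: a_elt b_elt)
    next
      case (step2 i)
      then show ?case
        using cl[OF _ cl[of b "elt False i"], of a] by (simp add: a_elt b_elt)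
    qed
    then show ?thesis
      using cl[of a "elt False i"] by (cases e) (simp_all add: a_elt)
  qed
  then show "{elt e i | e i. True} \<subseteq> word_prod G ` lists {a, b}"
    by blast
qed

text \<open>\<open>twist\<close> changes only the exponent and \<open>a\<close> only the flag
  \<open>e\<close>, so they commute. Injectivity gives bijectivity since the dihedral group is
  finite.\<close>

lemma twist:
  shows "bij_betw twist (word_prod G ` lists {a, b}) (word_prod G ` lists {a, b})"
    and "twist \<one> = \<one>"
    and "\<And>d. d \<in> word_prod G ` lists {a, b} \<Longrightarrow> twist (a \<otimes> d) = a \<otimes> twist d"
    and "\<And>xs. set xs \<subseteq> {a, b} \<Longrightarrow>
      \<exists>ys. set ys \<subseteq> {a, c, r} \<and> length ys \<le> length xs \<and> word_prod G ys = twist (word_prod G xs)"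
proof -
  let ?D = "{elt e i | e i. True}"
  have "?D \<subseteq> (\<lambda>(e, i). elt e i) ` (UNIV \<times> {- 2 * int k..2 * int k + 1})"
  proof
    fix d
    assume "d \<in> ?D"
    then obtain e i where "d = elt e i"
      by blast
    then have "d = (\<lambda>(e, i). elt e i) (e, red i)"
      using red_cong by (simp add: elt_eq)
    then show "d \<in> (\<lambda>(e, i). elt e i) ` (UNIV \<times> {- 2 * int k..2 * int k + 1})"
      by (rule image_eqI) (use red_range in simp)
  qed
  then have fin: "finite ?D"
    by (rule finite_subset) simp
  have inj: "inj_on twist ?D"
  proof (rule inj_onI)
    fix x y
    assume "x \<in> ?D" "y \<in> ?D" and eq: "twist x = twist y"
    then obtain e i e' j where xy: "x = elt e i" "y = elt e' j"
      by blast
    then have "e = e'" "period dvd shift (red i) - shift (red j)"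
      using eq by (simp_all add: twist_elt elt_eq)
    then show "x = y"
      unfolding xy elt_eq using shift_eq red_eq by blast
  qed
  have "twist ` ?D \<subseteq> ?D"
    using twist_elt by fastforce
  then show "bij_betw twist (word_prod G ` lists {a, b}) (word_prod G ` lists {a, b})"
    unfolding dihedral_elts bij_betw_def using endo_inj_surj[OF fin _ inj] inj by simp
  have "\<one> = elt False 0"
    by (simp add: elt_def)
  moreover have "red 0 = 0"
    by (simp add: red_def period_def)
  ultimately show "twist \<one> = \<one>"
    by (simp add: twist_elt shift_def)
  show "twist (a \<otimes> d) = a \<otimes> twist d" if "d \<in> word_prod G ` lists {a, b}" for d
    using that unfolding dihedral_elts by (auto simp: twist_elt a_elt)
  show "\<exists>ys. set ys \<subseteq> {a, c, r} \<and> length ys \<le> length xs \<and> word_prod G ys = twist (word_prod G xs)"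
    if xs: "set xs \<subseteq> {a, b}" for xs
  proof -
    obtain e i where ei: "word_prod G xs = elt e i" "\<bar>2 * i + of_bool e\<bar> \<le> int (length xs)"
      using word_ab[OF xs] by blast
    then show ?thesis
      using word_shift[OF ei(2)] by (simp add: twist_elt)
  qed
qed

end

section \<open>The twisted action\<close>

lemma (in coxeter) coxeter_m_commute:
  assumes "s \<in> S" "t \<in> S"
  shows "coxeter_m W s t = coxeter_m W t s"
proof -
  have "t \<otimes> s = inv (s \<otimes> t)"
    using assms by (simp add: inv_mult_group)
  then have "ord (t \<otimes> s) = ord (s \<otimes> t)"
    using assms by simp
  then show ?thesis
    by (simp add: coxeter_m_def)
qed

lemma (in coxeter) m_two_commute:
  assumes s: "s \<in> S" and t: "t \<in> S" and "coxeter_m W s t = 2"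
  shows "s \<otimes> t = t \<otimes> s"
proof -
  have "(s \<otimes> t) [^] (2 :: nat) = \<one>"
    using coxeter_m_pow[OF s t, of 2] assms by (simp add: numeral_eq_enat)
  then have "(s \<otimes> t) \<otimes> (s \<otimes> t) = \<one>"
    using s t by (simp add: numeral_2_eq_2)
  then have "inv (s \<otimes> t) = s \<otimes> t"
    using s t by (intro inv_equality) simp_all
  then show ?thesis
    using s t by (simp add: inv_mult_group)
qed

lemma (in coxeter) par_commute:
  assumes I: "I \<subseteq> S" and J: "J \<subseteq> S"
    and comm: "\<And>s t. s \<in> I \<Longrightarrow> t \<in> J \<Longrightarrow> s \<otimes> t = t \<otimes> s"
    and u: "u \<in> par I" and v: "v \<in> par J"
  shows "u \<otimes> v = v \<otimes> u"
proof -
  have cancel: "x \<otimes> y \<otimes> z = z \<otimes> (x \<otimes> y)"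
    if "x \<in> carrier W" "y \<in> carrier W" "z \<in> carrier W" "x \<otimes> z = z \<otimes> x" "y \<otimes> z = z \<otimes> y" for x y z
    using that by (metis m_assoc)
  have gen: "s \<otimes> v = v \<otimes> s" if s: "s \<in> I" for s
  proof -
    obtain ys where "set ys \<subseteq> J" "word_prod W ys = v"
      using v by (rule parE)
    moreover have "set ys \<subseteq> J \<Longrightarrow> word_prod W ys \<otimes> s = s \<otimes> word_prod W ys" for ys
    proof (induction ys)
      case Nil
      then show ?case using s I by auto
    next
      case (Cons y ys)
      then have "word_prod W ys \<in> carrier W" "y \<in> carrier W" "s \<in> carrier W"
        using J I s S_carrier by auto
      then show ?case
        using Cons comm[OF s, of y] cancel by simp
    qed
    ultimately show ?thesis
      by metis
  qed
  obtain xs where "set xs \<subseteq> I" "word_prod W xs = u"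
    using u by (rule parE)
  moreover have "v \<in> carrier W"
    using v par_carrier J by auto
  moreover have "set xs \<subseteq> I \<Longrightarrow> word_prod W xs \<otimes> v = v \<otimes> word_prod W xs" for xs
  proof (induction xs)
    case Nil
    then show ?case using \<open>v \<in> carrier W\<close> by simp
  next
    case (Cons x xs)
    then have "word_prod W xs \<in> carrier W" "x \<in> carrier W"
      using I S_carrier by auto
    then show ?case
      using Cons gen[of x] cancel \<open>v \<in> carrier W\<close> by simp
  qed
  ultimately show ?thesis
    by metis
qed

lemma (in coxeter) par_Un:
  assumes I: "I \<subseteq> S" and J: "J \<subseteq> S"
    and comm: "\<And>s t. s \<in> I \<Longrightarrow> t \<in> J \<Longrightarrow> s \<otimes> t = t \<otimes> s"
    and w: "w \<in> par (I \<union> J)"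
  shows "\<exists>u \<in> par I. \<exists>v \<in> par J. w = u \<otimes> v"
proof -
  obtain xs where "set xs \<subseteq> I \<union> J" "word_prod W xs = w"
    using w by (rule parE)
  moreover have "set xs \<subseteq> I \<union> J \<Longrightarrow> \<exists>u \<in> par I. \<exists>v \<in> par J. word_prod W xs = u \<otimes> v" for xs
  proof (induction xs)
    case Nil
    show ?case
      by (intro bexI[of _ \<one>]) auto
  next
    case (Cons x xs)
    then obtain u v where uv: "u \<in> par I" "v \<in> par J" "word_prod W xs = u \<otimes> v"
      by auto
    then have cl: "u \<in> carrier W" "v \<in> carrier W" "x \<in> carrier W"
      using par_carrier I J S_carrier Cons.prems by auto
    show ?case
    proof (cases "x \<in> I")
      case True
      then have "x \<otimes> u \<in> par I"
        using par_mult[OF I gen_in_par[OF True I]] uv by blast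
      moreover have "word_prod W (x # xs) = x \<otimes> u \<otimes> v"
        using uv cl by (simp add: m_assoc)
      ultimately show ?thesis
        using uv by blast
    next
      case False
      then have x: "x \<in> par J"
        using Cons.prems J by (intro gen_in_par) auto
      then have "x \<otimes> v \<in> par J"
        using uv by (intro par_mult[OF J])
      moreover have "word_prod W (x # xs) = u \<otimes> (x \<otimes> v)"
        using uv cl par_commute[OF I J comm uv(1) x] by (simp flip: m_assoc)
      ultimately show ?thesis
        using uv by blast
    qed
  qed
  ultimately show ?thesis
    by blast
qed

locale pseudo_coxeter = coxeter W S for W :: "('a, 'b) monoid_scheme" (structure) and S +
  fixes a b :: 'a and k :: nat
  assumes aS [simp]: "a \<in> S" and bS [simp]: "b \<in> S" and a_neq_b: "a \<noteq> b" and k_pos: "k \<ge> 1"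
    and m_ab: "coxeter_m W a b = enat (2 * (2 * k + 1))"
    and m_b: "\<And>s. s \<in> S - {a, b} \<Longrightarrow> coxeter_m W s b \<in> {2, \<infinity>}"
    and m_a: "\<And>s. s \<in> S - {a, b} \<Longrightarrow> coxeter_m W s b = 2 \<Longrightarrow> coxeter_m W s a = 2"

sublocale pseudo_coxeter \<subseteq> D: dihedral W a b k
proof
  show "ord (b \<otimes> a) = 2 * (2 * k + 1)"
    using m_ab coxeter_m_commute[OF aS bS] unfolding coxeter_m_def by (auto split: if_splits)
qed (use k_pos in auto)

context pseudo_coxeter begin

definition J :: "'a set" where "J = {s \<in> S - {a, b}. coxeter_m W s b = 2}"

abbreviation I :: "'a set" where "I \<equiv> {a, b} \<union> J"

abbreviation D :: "'a set" where "D \<equiv> par {a, b}"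

abbreviation f :: "'a \<Rightarrow> 'a" where "f \<equiv> D.twist"

lemma ab_S: "{a, b} \<subseteq> S" and J_S: "J \<subseteq> S" and I_S: "I \<subseteq> S"
  by (auto simp: J_def)

text \<open>A member of \<open>J\<close> commutes with \<open>b\<close> by definition, and then with
  \<open>a\<close> by \<open>m_a\<close>.\<close>

lemma commute_gens: "s \<in> {a, b} \<Longrightarrow> t \<in> J \<Longrightarrow> s \<otimes> t = t \<otimes> s"
  using m_two_commute[of t b] m_two_commute[of t a] m_a[of t] by (auto simp: J_def)

lemma commute: "d \<in> D \<Longrightarrow> v \<in> par J \<Longrightarrow> d \<otimes> v = v \<otimes> d"
  using par_commute[OF ab_S J_S commute_gens] .

lemma D_carrier: "d \<in> D \<Longrightarrow> d \<in> carrier W" and J_carrier: "v \<in> par J \<Longrightarrow> v \<in> carrier W"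
  and I_carrier: "u \<in> par I \<Longrightarrow> u \<in> carrier W"
  using par_carrier[OF ab_S] par_carrier[OF J_S] par_carrier[OF I_S] by blast+

lemma D_I: "d \<in> D \<Longrightarrow> d \<in> par I" and J_I: "v \<in> par J \<Longrightarrow> v \<in> par I"
  using par_mono[of "{a, b}" I] par_mono[of J I] by auto

lemma D_Int_J: "D \<inter> par J = {\<one>}"
  by (rule par_Int[OF ab_S J_S]) (auto simp: J_def)

section \<open>Minimal coset representatives and the factorisation \<open>g = d v h\<close>\<close>

definition coset :: "'a \<Rightarrow> 'a set" where
  "coset g = (\<lambda>u. u \<otimes> g) ` par I"

text \<open>Chosen from the coset as a set, so that it is constant on cosets
  (\<open>rep_mult\<close>).\<close>

definition rep :: "'a \<Rightarrow> 'a" where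
  "rep g = (SOME h. h \<in> coset g \<and> (\<forall>h' \<in> coset g. len h \<le> len h'))"

lemma coset_mult:
  assumes u: "u \<in> par I" and g: "g \<in> carrier W"
  shows "coset (u \<otimes> g) = coset g"
proof
  show "coset (u \<otimes> g) \<subseteq> coset g"
  proof
    fix x
    assume "x \<in> coset (u \<otimes> g)"
    then obtain v where v: "v \<in> par I" "x = v \<otimes> (u \<otimes> g)"
      unfolding coset_def by blast
    then have "x = (v \<otimes> u) \<otimes> g"
      using u g I_carrier by (simp add: m_assoc)
    with par_mult[OF I_S v(1) u] show "x \<in> coset g"
      unfolding coset_def by blast
  qed
  show "coset g \<subseteq> coset (u \<otimes> g)"
  proof
    fix x
    assume "x \<in> coset g"
    then obtain v where v: "v \<in> par I" "x = v \<otimes> g"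
      unfolding coset_def by blast
    then have "x = (v \<otimes> inv u) \<otimes> (u \<otimes> g)"
      using u g I_carrier by (simp add: m_assoc inv_cancel_left)
    with par_mult[OF I_S v(1) par_inv[OF I_S u]] show "x \<in> coset (u \<otimes> g)"
      unfolding coset_def by blast
  qed
qed

lemma rep_mult: "u \<in> par I \<Longrightarrow> g \<in> carrier W \<Longrightarrow> rep (u \<otimes> g) = rep g"
  unfolding rep_def by (simp add: coset_mult)

lemma rep_props:
  assumes g: "g \<in> carrier W"
  shows "rep g \<in> coset g" and "\<And>h. h \<in> coset g \<Longrightarrow> len (rep g) \<le> len h"
proof -
  have "g \<in> coset g"
    unfolding coset_def using g by (intro image_eqI[of _ _ \<one>]) auto
  from ex_has_least_nat[of "\<lambda>h. h \<in> coset g", OF this, of len]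
  have "\<exists>h. h \<in> coset g \<and> (\<forall>h' \<in> coset g. len h \<le> len h')"
    by blast
  from someI_ex[OF this]
  have "rep g \<in> coset g \<and> (\<forall>h' \<in> coset g. len (rep g) \<le> len h')"
    unfolding rep_def .
  then show "rep g \<in> coset g" "\<And>h. h \<in> coset g \<Longrightarrow> len (rep g) \<le> len h"
    by blast+
qed

lemma rep_carrier: "g \<in> carrier W \<Longrightarrow> rep g \<in> carrier W"
  using rep_props(1)[of g] I_carrier unfolding coset_def by auto

lemma rep_rep: "g \<in> carrier W \<Longrightarrow> rep (rep g) = rep g"
  using rep_props(1)[of g] rep_mult unfolding coset_def by auto

lemma rep_min:
  assumes g: "g \<in> carrier W" and u: "u \<in> par I"
  shows "len (rep g) \<le> len (u \<otimes> rep g)"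
proof -
  have "coset (rep g) = coset g"
    using rep_props(1)[OF g] coset_mult[OF _ g] unfolding coset_def[of g] by auto
  moreover have "u \<otimes> rep g \<in> coset (rep g)"
    unfolding coset_def using u by blast
  ultimately show ?thesis
    using rep_props(2)[OF g] by simp
qed

lemma decomposition:
  assumes g: "g \<in> carrier W"
  obtains d v where "d \<in> D" "v \<in> par J" "g = d \<otimes> (v \<otimes> rep g)"
proof -
  obtain u where u: "u \<in> par I" "rep g = u \<otimes> g"
    using rep_props(1)[OF g] unfolding coset_def by blast
  then have "g = inv u \<otimes> rep g"
    using g I_carrier by (simp add: inv_cancel_left)
  moreover obtain d v where "d \<in> D" "v \<in> par J" "inv u = d \<otimes> v"
    using par_Un[OF ab_S J_S commute_gens par_inv[OF I_S u(1)]] by blast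
  ultimately have "g = d \<otimes> (v \<otimes> rep g)"
    using D_carrier J_carrier rep_carrier[OF g] by (simp add: m_assoc)
  with \<open>d \<in> D\<close> \<open>v \<in> par J\<close> show ?thesis
    by (rule that)
qed

definition dpart :: "'a \<Rightarrow> 'a" where
  "dpart g = (THE d. d \<in> D \<and> (\<exists>v \<in> par J. g = d \<otimes> (v \<otimes> rep g)))"

text \<open>Cancelling \<open>h\<close> leaves
  \<open>inv d' \<otimes> d = v' \<otimes> inv v\<close>, an element of both \<open>D\<close> and
  \<open>par J\<close>, hence trivial.\<close>

lemma decomposition_unique:
  assumes "h \<in> carrier W" "d \<in> D" "v \<in> par J" "d' \<in> D" "v' \<in> par J" "d \<otimes> (v \<otimes> h) = d' \<otimes> (v' \<otimes> h)"
  shows "d = d'"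
proof -
  have cl: "d \<in> carrier W" "d' \<in> carrier W" "v \<in> carrier W" "v' \<in> carrier W"
    using assms D_carrier J_carrier by auto
  then have "d \<otimes> v \<otimes> h = d' \<otimes> v' \<otimes> h"
    using assms by (simp add: m_assoc)
  then have "d \<otimes> v = d' \<otimes> v'"
    using assms(1) cl by simp
  then have "inv d' \<otimes> (d \<otimes> v) \<otimes> inv v = inv d' \<otimes> (d' \<otimes> v') \<otimes> inv v"
    by simp
  then have eq: "inv d' \<otimes> d = v' \<otimes> inv v"
    using cl by (simp add: m_assoc inv_cancel_left)
  have "inv d' \<otimes> d \<in> D" "v' \<otimes> inv v \<in> par J"
    using assms par_mult par_inv ab_S J_S by auto
  then have "inv d' \<otimes> d = \<one>"
    using D_Int_J eq by auto
  then show ?thesis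
    using cl by (metis inv_inv inv_equality inv_closed)
qed

lemma dpart_eq:
  assumes h: "h \<in> carrier W" "rep h = h" and d: "d \<in> D" and v: "v \<in> par J"
  shows "dpart (d \<otimes> (v \<otimes> h)) = d"
proof -
  have cl: "d \<in> carrier W" "v \<in> carrier W"
    using d v D_carrier J_carrier by auto
  have rep: "rep (d \<otimes> (v \<otimes> h)) = h"
    using rep_mult[OF D_I[OF d]] rep_mult[OF J_I[OF v] h(1)] h cl by simp
  show ?thesis
    unfolding dpart_def rep
  proof (rule the_equality)
    show "d \<in> D \<and> (\<exists>v' \<in> par J. d \<otimes> (v \<otimes> h) = d \<otimes> (v' \<otimes> h))"
      using d v by blast
  next
    fix d'
    assume "d' \<in> D \<and> (\<exists>v' \<in> par J. d \<otimes> (v \<otimes> h) = d' \<otimes> (v' \<otimes> h))"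
    then show "d' = d"
      using decomposition_unique[OF h(1) d v] by metis
  qed
qed

section \<open>The action of the dihedral group twisted by \<open>f\<close>\<close>

definition twisted_mult :: "'a \<Rightarrow> 'a \<Rightarrow> 'a" where
  "twisted_mult e d = inv_into D f (e \<otimes> f d)"

text \<open>Only the dihedral factor \<open>d\<close> of \<open>g = d v h\<close> is changed; the
  remaining factor \<open>v h\<close> is recovered as
  \<open>inv (dpart g) \<otimes> g\<close>.\<close>

definition twisted :: "'a \<Rightarrow> 'a \<Rightarrow> 'a" where
  "twisted e g = twisted_mult e (dpart g) \<otimes> (inv (dpart g) \<otimes> g)"

lemma f_bij: "bij_betw f D D"
  using D.twist(1) unfolding par_def .

lemma f_D: "d \<in> D \<Longrightarrow> f d \<in> D" and finv_D: "d \<in> D \<Longrightarrow> inv_into D f d \<in> D"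
  and f_finv: "d \<in> D \<Longrightarrow> f (inv_into D f d) = d" and finv_f: "d \<in> D \<Longrightarrow> inv_into D f (f d) = d"
  using bij_betwE[OF f_bij] bij_betwE[OF bij_betw_inv_into[OF f_bij]]
    bij_betw_inv_into_left[OF f_bij] bij_betw_inv_into_right[OF f_bij] by blast+

lemma D_mult: "d \<in> D \<Longrightarrow> e \<in> D \<Longrightarrow> d \<otimes> e \<in> D"
  by (rule par_mult[OF ab_S])

lemma twisted_mult_D: "e \<in> D \<Longrightarrow> d \<in> D \<Longrightarrow> twisted_mult e d \<in> D"
  unfolding twisted_mult_def by (intro finv_D D_mult f_D)

lemma twisted_eq:
  assumes h: "h \<in> carrier W" "rep h = h" and d: "d \<in> D" and v: "v \<in> par J"
  shows "twisted e (d \<otimes> (v \<otimes> h)) = twisted_mult e d \<otimes> (v \<otimes> h)"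
  unfolding twisted_def dpart_eq[OF assms] using D_carrier[OF d] J_carrier[OF v] h
  by (simp add: inv_cancel_left)

lemma carrier_cases:
  assumes "g \<in> carrier W"
  obtains d v h where "h \<in> carrier W" "rep h = h" "d \<in> D" "v \<in> par J" "g = d \<otimes> (v \<otimes> h)"
  using decomposition[OF assms] rep_carrier[OF assms] rep_rep[OF assms] by metis

lemma twisted_carrier:
  assumes "e \<in> D" "g \<in> carrier W"
  shows "twisted e g \<in> carrier W"
  using assms(2)
proof (rule carrier_cases)
  fix d v h
  assume "h \<in> carrier W" "rep h = h" "d \<in> D" "v \<in> par J" "g = d \<otimes> (v \<otimes> h)"
  then show ?thesis
    using twisted_eq twisted_mult_D[OF assms(1)] D_carrier J_carrier by simp
qed

text \<open>Between the two twisted multiplications \<open>f\<close> cancels its inverse, so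
  \<open>D\<close> acts.\<close>

lemma twisted_twisted:
  assumes e: "e \<in> D" "e' \<in> D" and g: "g \<in> carrier W"
  shows "twisted e (twisted e' g) = twisted (e \<otimes> e') g"
  using g
proof (rule carrier_cases)
  fix d v h
  assume *: "h \<in> carrier W" "rep h = h" "d \<in> D" "v \<in> par J" "g = d \<otimes> (v \<otimes> h)"
  have "twisted_mult e (twisted_mult e' d) = twisted_mult (e \<otimes> e') d"
    unfolding twisted_mult_def using * e f_D D_mult D_carrier by (simp add: f_finv m_assoc)
  then show ?thesis
    using * e by (simp add: twisted_eq twisted_mult_D)
qed

lemma twisted_one: "g \<in> carrier W \<Longrightarrow> twisted \<one> g = g"
proof (erule carrier_cases)
  fix d v h
  assume *: "h \<in> carrier W" "rep h = h" "d \<in> D" "v \<in> par J" "g = d \<otimes> (v \<otimes> h)"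
  then have "twisted_mult \<one> d = d"
    unfolding twisted_mult_def using D_carrier f_D finv_f by simp
  then show "twisted \<one> g = g"
    using * by (simp add: twisted_eq)
qed

lemma a_D: "a \<in> D" and b_D: "b \<in> D"
  by (rule gen_in_par; use ab_S in auto)+

text \<open>Since \<open>f\<close> commutes with left multiplication by \<open>a\<close>,
  conjugating that multiplication by \<open>f\<close> changes nothing.\<close>

lemma twisted_a: "g \<in> carrier W \<Longrightarrow> twisted a g = a \<otimes> g"
proof (erule carrier_cases)
  fix d v h
  assume *: "h \<in> carrier W" "rep h = h" "d \<in> D" "v \<in> par J" "g = d \<otimes> (v \<otimes> h)"
  have "f (a \<otimes> d) = a \<otimes> f d"
    using D.twist(3)[of d] \<open>d \<in> D\<close> unfolding par_def by simp
  then have "twisted_mult a d = a \<otimes> d"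
    unfolding twisted_mult_def using finv_f[OF D_mult[OF a_D \<open>d \<in> D\<close>]] by simp
  then show "twisted a g = a \<otimes> g"
    using * D_carrier J_carrier by (simp add: twisted_eq m_assoc)
qed

text \<open>\<open>u\<close> passes through the dihedral factor and merges with the factor in
  \<open>par J\<close>, so both sides twist the same dihedral factor.\<close>

lemma twisted_commute:
  assumes e: "e \<in> D" and u: "u \<in> par J" and g: "g \<in> carrier W"
  shows "twisted e (u \<otimes> g) = u \<otimes> twisted e g"
  using g
proof (rule carrier_cases)
  fix d v h
  assume *: "h \<in> carrier W" "rep h = h" "d \<in> D" "v \<in> par J" "g = d \<otimes> (v \<otimes> h)"
  have uv: "u \<otimes> v \<in> par J"
    by (rule par_mult[OF J_S u *(4)])
  have swap: "u \<otimes> (x \<otimes> (v \<otimes> h)) = x \<otimes> (u \<otimes> v \<otimes> h)" if x: "x \<in> D" for x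
  proof -
    have cl: "x \<in> carrier W" "u \<in> carrier W" "v \<in> carrier W"
      using x u * D_carrier J_carrier by auto
    then have "u \<otimes> (x \<otimes> (v \<otimes> h)) = (u \<otimes> x) \<otimes> (v \<otimes> h)"
      using * by (simp add: m_assoc)
    also have "\<dots> = x \<otimes> (u \<otimes> v \<otimes> h)"
      unfolding commute[OF x u, symmetric] using cl * by (simp add: m_assoc)
    finally show ?thesis .
  qed
  show ?thesis
    unfolding *(5) swap[OF *(3)] twisted_eq[OF *(1-4)] twisted_eq[OF *(1-3) uv]
    using swap[OF twisted_mult_D[OF e *(3)]] by simp
qed

section \<open>The generators acting on \<open>W\<close>, with \<open>b\<close> twisted\<close>

definition act :: "'a \<Rightarrow> 'a \<Rightarrow> 'a" where
  "act s g = (if s = b then twisted b g else s \<otimes> g)"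

lemma act_ab: "s \<in> {a, b} \<Longrightarrow> g \<in> carrier W \<Longrightarrow> act s g = twisted s g"
  using twisted_a a_neq_b by (auto simp: act_def)

lemma act_closed: "s \<in> S \<Longrightarrow> g \<in> carrier W \<Longrightarrow> act s g \<in> carrier W"
  using twisted_carrier[OF b_D] by (auto simp: act_def)

lemma act_act: "s \<in> S \<Longrightarrow> g \<in> carrier W \<Longrightarrow> act s (act s g) = g"
  using twisted_twisted[OF b_D b_D] twisted_one by (auto simp: act_def)

lemma act_pow_mult:
  assumes "s \<in> S - {b}" "t \<in> S - {b}" "g \<in> carrier W"
  shows "((act s \<circ> act t) ^^ n) g = (s \<otimes> t) [^] n \<otimes> g"
proof (induction n)
  case (Suc n)
  have "(s \<otimes> t) [^] Suc n = (s \<otimes> t) \<otimes> (s \<otimes> t) [^] n"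
    using assms by (intro nat_pow_Suc2) simp
  then show ?case
    using Suc assms by (simp add: act_def m_assoc del: nat_pow_Suc)
qed (use assms in simp)

lemma act_pow_twisted:
  assumes s: "s \<in> {a, b}" and t: "t \<in> {a, b}" and g: "g \<in> carrier W"
  shows "((act s \<circ> act t) ^^ n) g = twisted ((s \<otimes> t) [^] n) g \<and> (s \<otimes> t) [^] n \<in> D"
proof (induction n)
  case 0
  then show ?case
    using g twisted_one by simp
next
  case (Suc n)
  have st: "s \<in> D" "t \<in> D" "s \<otimes> t \<in> D"
    using s t a_D b_D D_mult by auto
  have "(s \<otimes> t) [^] Suc n = (s \<otimes> t) \<otimes> (s \<otimes> t) [^] n"
    using st D_carrier by (intro nat_pow_Suc2) simp
  moreover have "((act s \<circ> act t) ^^ Suc n) g = twisted s (twisted t (twisted ((s \<otimes> t) [^] n) g))"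
    unfolding funpow.simps comp_apply
    using Suc g act_ab[OF t] act_ab[OF s] st by (simp add: twisted_carrier comp_def)
  moreover have "s \<otimes> (t \<otimes> (s \<otimes> t) [^] n) = s \<otimes> t \<otimes> (s \<otimes> t) [^] n"
    using st D_carrier by (simp add: m_assoc)
  ultimately show ?case
    using Suc g st D_mult by (simp add: twisted_twisted twisted_carrier del: nat_pow_Suc)
qed

lemma act_commute:
  assumes "s \<in> J" "g \<in> carrier W"
  shows "act s (act b g) = act b (act s g)"
proof -
  have "s \<in> par J" "s \<noteq> b"
    using assms gen_in_par[of s J] J_S by (auto simp: J_def)
  then show ?thesis
    using twisted_commute[OF b_D _ assms(2)] by (simp add: act_def)
qed

text \<open>Relations avoiding \<open>b\<close> hold for left multiplication, and those between
  \<open>a\<close> and \<open>b\<close> for the twisted action of \<open>D\<close>. A finite order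
  of the product of \<open>b\<close> with any other generator is 2 and puts that generator into
  \<open>J\<close>, where the actions commute.\<close>

lemma act_relation:
  assumes s: "s \<in> S" and t: "t \<in> S" and m: "coxeter_m W s t = enat n" and g: "g \<in> carrier W"
  shows "((act s \<circ> act t) ^^ n) g = g"
proof -
  have pow: "(s \<otimes> t) [^] n = \<one>"
    using coxeter_m_pow[OF s t m] .
  have J: "s \<in> J \<and> n = 2" if "s \<in> S - {a, b}" "coxeter_m W s b = enat n" for s
    using m_b[OF that(1)] that by (auto simp: J_def numeral_eq_enat)
  consider "s \<in> S - {b}" "t \<in> S - {b}" | "s \<in> {a, b}" "t \<in> {a, b}"
    | "s = b" "t \<in> S - {a, b}" | "s \<in> S - {a, b}" "t = b"
    using s t by blast
  then show ?thesis
  proof cases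
    case 1
    then show ?thesis
      using act_pow_mult[OF 1 g] pow g by simp
  next
    case 2
    then show ?thesis
      using act_pow_twisted[OF 2 g] pow twisted_one[OF g] by simp
  next
    case 3
    then have "t \<in> J" "n = 2"
      using J[of t] m coxeter_m_commute[OF s t] by auto
    then show ?thesis
      using 3 g act_commute act_act act_closed by (simp add: numeral_2_eq_2)
  next
    case 4
    then have "s \<in> J" "n = 2"
      using J[of s] m by auto
    then show ?thesis
      using 4 g act_commute act_act act_closed by (simp add: numeral_2_eq_2)
  qed
qed

section \<open>The orbit map of the identity and short preimages\<close>

definition psi :: "'a \<Rightarrow> 'a" where
  "psi x = foldr act (SOME xs. set xs \<subseteq> S \<and> word_prod W xs = x) \<one>"

lemma psi_word:
  assumes "set xs \<subseteq> S"
  shows "psi (word_prod W xs) = foldr act xs \<one>"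
  unfolding psi_def
proof (rule someI2[where a = xs])
  fix ys
  assume "set ys \<subseteq> S \<and> word_prod W ys = word_prod W xs"
  then show "foldr act ys \<one> = foldr act xs \<one>"
    using assms act_closed act_act act_relation
    by (intro coxeter_action[where Z = "carrier W"]) blast+
qed (use assms in simp)

lemma psi_one: "psi \<one> = \<one>"
  using psi_word[of "[]"] by simp

lemma psi_gen:
  assumes s: "s \<in> S" and x: "x \<in> carrier W"
  shows "psi (s \<otimes> x) = act s (psi x)"
proof -
  obtain xs where xs: "set xs \<subseteq> S" "word_prod W xs = x"
    using reduced_word_S[OF x] by blast
  then show ?thesis
    using psi_word[of "s # xs"] psi_word[of xs] s by auto
qed

lemma psi_carrier:
  assumes x: "x \<in> carrier W"
  shows "psi x \<in> carrier W"
proof -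
  obtain xs where xs: "set xs \<subseteq> S" "word_prod W xs = x"
    using reduced_word_S[OF x] by blast
  then have "psi x = foldr act xs \<one>"
    using psi_word[of xs] by simp
  also have "\<dots> \<in> carrier W"
    using act_closed xs by (intro foldr_mem[where S = S]) auto
  finally show ?thesis .
qed

text \<open>Both \<open>a\<close> and \<open>b\<close> act as \<open>twisted\<close>, the former by
  \<open>twisted_a\<close>, so all of \<open>D\<close> does.\<close>

lemma psi_D:
  assumes d: "d \<in> D" and x: "x \<in> carrier W"
  shows "psi (d \<otimes> x) = twisted d (psi x)"
proof -
  obtain xs where "set xs \<subseteq> {a, b}" "word_prod W xs = d"
    using d by (rule parE)
  moreover have "set xs \<subseteq> {a, b} \<Longrightarrow> psi (word_prod W xs \<otimes> x) = twisted (word_prod W xs) (psi x)" for xs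
  proof (induction xs)
    case Nil
    then show ?case
      using x twisted_one psi_carrier by simp
  next
    case (Cons y ys)
    then have y: "y \<in> {a, b}" "y \<in> S" "y \<in> D" and ys: "word_prod W ys \<in> D"
      using a_D b_D ab_S word_in_par[of ys "{a, b}"] by auto
    then have "psi (word_prod W (y # ys) \<otimes> x) = act y (psi (word_prod W ys \<otimes> x))"
      using x D_carrier psi_gen[OF y(2)] by (simp add: m_assoc)
    also have "\<dots> = twisted y (twisted (word_prod W ys) (psi x))"
      using Cons y ys x psi_carrier act_ab[OF y(1)] by (simp add: twisted_carrier)
    finally show ?case
      using y ys x psi_carrier by (simp add: twisted_twisted)
  qed
  ultimately show ?thesis
    by blast
qed

lemma psi_J:
  assumes v: "v \<in> par J" and x: "x \<in> carrier W"
  shows "psi (v \<otimes> x) = v \<otimes> psi x"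
proof -
  obtain xs where "set xs \<subseteq> J" "word_prod W xs = v"
    using v by (rule parE)
  moreover have "set xs \<subseteq> J \<Longrightarrow> psi (word_prod W xs \<otimes> x) = word_prod W xs \<otimes> psi x" for xs
  proof (induction xs)
    case Nil
    then show ?case
      using x psi_carrier by simp
  next
    case (Cons y ys)
    then have y: "y \<in> S" "y \<noteq> b" and ys: "word_prod W ys \<in> carrier W"
      using J_carrier[OF word_in_par[of ys J]] by (auto simp: J_def)
    then show ?case
      using Cons x psi_carrier psi_gen[OF y(1)] by (simp add: m_assoc act_def)
  qed
  ultimately show ?thesis
    by blast
qed

abbreviation T :: "'a set" where "T \<equiv> (S - {b}) \<union> {D.c, D.r}"

lemma T_carrier: "T \<subseteq> carrier W"
  by (auto simp: D.c_def D.r_def)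

lemma psi_surj:
  assumes "g \<in> carrier W"
  shows "\<exists>ys. set ys \<subseteq> T \<and> length ys \<le> len g \<and> psi (word_prod W ys) = g"
  using assms
proof (induction "len g" arbitrary: g rule: less_induct)
  case less
  note g = less.prems
  obtain d v where d: "d \<in> D" and v: "v \<in> par J" and g_eq: "g = d \<otimes> (v \<otimes> rep g)"
    using decomposition[OF g] .
  define h where "h = rep g"
  have h: "h \<in> carrier W" "rep h = h" and h_min: "\<And>u. u \<in> par I \<Longrightarrow> len h \<le> len (u \<otimes> h)"
    using g rep_carrier rep_rep rep_min unfolding h_def by auto
  have cl: "d \<in> carrier W" "v \<in> carrier W"
    using d v D_carrier J_carrier by auto
  have "x = \<one>" if "x \<in> D" "x \<in> par J" for x
    using D_Int_J that by auto
  \<comment> \<open>Inversions of \<open>v\<close> lie in \<open>par J\<close>, which meets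
    \<open>D\<close> only in the identity, and the identity is never an inversion.\<close>
  then have "inv_set v \<inter> D = {}"
    using inv_set_par[OF J_S v] one_notin_inv_set[OF cl(2)] by blast
  then have len_dv: "len (d \<otimes> v) = len d + len v"
    using len_mult_disjoint[OF ab_S d cl(2)] by blast
  have "len (d \<otimes> v \<otimes> h) = len (d \<otimes> v) + len h"
    using d v D_I J_I h h_min by (intro len_mult_coset_min[OF I_S] par_mult[OF I_S]) auto
  then have len_g: "len g = len d + len v + len h"
    using len_dv g_eq cl h by (simp add: m_assoc h_def)
  \<comment> \<open>If \<open>g\<close> is itself the minimal representative, then \<open>h\<close>
    is no shorter than \<open>g\<close>, and the induction removes the first letter of a reduced
    word instead.\<close>
  show ?case
  proof (cases "len d + len v = 0")
    case True
    then have "d = \<one>" "v = \<one>"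
      using len_eq_0[OF cl(1)] len_eq_0[OF cl(2)] by simp_all
    then have g_h: "g = h"
      using g_eq h(1) unfolding h_def[symmetric] by simp
    obtain xs where xs: "set xs \<subseteq> S" "word_prod W xs = g" "length xs = len g"
      using g by (rule reduced_word_S)
    show ?thesis
    proof (cases xs)
      case Nil
      then show ?thesis
        using xs psi_one by (intro exI[of _ "[]"]) simp
    next
      case (Cons s zs)
      define g1 where "g1 = word_prod W zs"
      have s: "s \<in> S" and zs: "set zs \<subseteq> S" and len_zs: "Suc (length zs) = len g" and g_s: "g = s \<otimes> g1"
        using xs Cons by (auto simp: g1_def)
      have g1: "g1 \<in> carrier W" and len_g1: "len g1 \<le> length zs"
        using zs S_carrier len_word_prod[OF zs] unfolding g1_def by auto
      \<comment> \<open>If the reduced word began with \<open>b\<close>, then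
        \<open>b \<otimes> h\<close> would be shorter than the minimal representative
        \<open>h\<close>. So \<open>s\<close> is a letter of \<open>T\<close> and acts by left
        multiplication.\<close>
      have "s \<noteq> b"
      proof
        assume "s = b"
        then have "len h \<le> len (s \<otimes> h)"
          using h_min D_I b_D by simp
        moreover have "s \<otimes> h = g1"
          using g_h g_s s g1 by (metis sq_left)
        ultimately show False
          using len_g1 len_zs g_h by simp
      qed
      obtain ys where ys: "set ys \<subseteq> T" "length ys \<le> len g1" "psi (word_prod W ys) = g1"
        using less.hyps[of g1] g1 len_g1 len_zs by auto
      have "word_prod W ys \<in> carrier W"
        using ys T_carrier by (intro word_prod_closed) blast
      then have "psi (word_prod W (s # ys)) = g"
        using psi_gen[OF s] ys \<open>s \<noteq> b\<close> by (simp add: act_def g_s)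
      then show ?thesis
        using ys s \<open>s \<noteq> b\<close> len_g1 len_zs by (intro exI[of _ "s # ys"]) auto
    qed
  next
    case False
    then obtain ys where ys: "set ys \<subseteq> T" "length ys \<le> len h" "psi (word_prod W ys) = h"
      using less.hyps[of h] h len_g by auto
    define x where "x = word_prod W ys"
    have x: "x \<in> carrier W"
      using ys T_carrier unfolding x_def by (intro word_prod_closed) blast
    obtain ds where ds: "set ds \<subseteq> {a, b}" "word_prod W ds = d" "length ds = len d"
      using reduced_word[OF ab_S d] .
    obtain es where es: "set es \<subseteq> {a, D.c, D.r}" "length es \<le> length ds" "word_prod W es = f d"
      using D.twist(4)[OF ds(1)] ds(2) by blast
    obtain vs where vs: "set vs \<subseteq> J" "word_prod W vs = v" "length vs = len v"
      using reduced_word[OF J_S v] .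
    have T: "set es \<subseteq> T" "set vs \<subseteq> T"
      using es vs a_neq_b J_S by (auto simp: J_def)
    then have "set es \<subseteq> carrier W" "set vs \<subseteq> carrier W" "set ys \<subseteq> carrier W"
      using ys T_carrier by auto
    then have "word_prod W (es @ vs @ ys) = f d \<otimes> (v \<otimes> x)"
      using es vs by (simp add: word_prod_append x_def)
    moreover have "psi (f d \<otimes> (v \<otimes> x)) = g"
    proof -
      \<comment> \<open>The dihedral factor of \<open>v \<otimes> h\<close> is trivial and
        \<open>f \<one> = \<one>\<close>, so twisting by \<open>f d\<close> puts \<open>d\<close> in
        its place.\<close>
      have "psi (f d \<otimes> (v \<otimes> x)) = twisted (f d) (\<one> \<otimes> (v \<otimes> h))"
        using psi_D[OF f_D[OF d]] psi_J[OF v x] ys cl x h by (simp add: x_def)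
      also have "\<dots> = twisted_mult (f d) \<one> \<otimes> (v \<otimes> h)"
        by (rule twisted_eq[OF h one_in_par v])
      also have "twisted_mult (f d) \<one> = d"
        unfolding twisted_mult_def using D.twist(2) finv_f[OF d] D_carrier[OF f_D[OF d]] by simp
      finally show ?thesis
        using g_eq by (simp add: h_def)
    qed
    moreover have "length (es @ vs @ ys) \<le> len g"
      using es(2) ds(3) vs(3) ys(2) len_g by simp
    ultimately show ?thesis
      using T ys(1) by (intro exI[of _ "es @ vs @ ys"]) auto
  qed
qed

text \<open>Ensures that \<open>word_length W T\<close> is specified on all of \<open>W\<close> and
  that its balls are finite.\<close>

lemma T_words:
  assumes "g \<in> carrier W"
  shows "\<exists>ys. set ys \<subseteq> T \<and> word_prod W ys = g"
proof -
  obtain bs where bs: "set bs \<subseteq> {a, D.c, D.r}" "word_prod W bs = b"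
  proof -
    \<comment> \<open>In normal form \<open>b\<close> is a reflection with exponent -1, which is the
      even number \<open>- 2 * int k - 2\<close> plus half a period, so \<open>word_acr\<close>
      provides a word.\<close>
    have "D.elt True (- 1) = b"
      using D.b_elt[of False 0] by (simp add: D.elt_def)
    moreover have "- 2 * int k - 2 + (2 * int k + 1) = - 1"
      by simp
    ultimately show ?thesis
      using D.word_acr[of "- 2 * int k - 2" True] that by auto
  qed
  obtain xs where "set xs \<subseteq> S" "word_prod W xs = g"
    using reduced_word_S[OF assms] by blast
  moreover have "set xs \<subseteq> S \<Longrightarrow> \<exists>ys. set ys \<subseteq> T \<and> word_prod W ys = word_prod W xs" for xs
  proof (induction xs)
    case (Cons x xs)
    then obtain ys where ys: "set ys \<subseteq> T" "word_prod W ys = word_prod W xs"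
      by auto
    obtain zs where zs: "set zs \<subseteq> T" "word_prod W zs = x"
    proof (cases "x = b")
      case True
      moreover have "set bs \<subseteq> T"
        by (rule subset_trans[OF bs(1)]) (use a_neq_b in auto)
      ultimately show ?thesis
        using that bs(2) by metis
    next
      case False
      then show ?thesis
        using Cons.prems that[of "[x]"] by auto
    qed
    then have "word_prod W (zs @ ys) = word_prod W (x # xs)"
      using ys T_carrier by (subst word_prod_append) auto
    then show ?case
      using ys zs by (intro exI[of _ "zs @ ys"]) auto
  qed (intro exI[of _ "[]"], simp)
  ultimately show ?thesis
    by blast
qed

end

section \<open>Comparing growth rates\<close>

lemma root_le_imp_le_power:
  assumes "n > 0" "root n x \<le> c" "x \<ge> 0"
  shows "x \<le> c ^ n"
  using assms by (metis power_mono real_root_ge_zero real_root_pow_pos2)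

text \<open>\<open>C\<close> absorbs the finitely many terms before the bound takes effect, and the
  factor \<open>n + 1\<close> counts the summands; \<open>c \<ge> 1\<close> makes the powers
  increasing.\<close>

lemma sum_le_geometric:
  fixes \<tau> :: "nat \<Rightarrow> nat"
  assumes c: "c \<ge> 1" and ev: "\<forall>\<^sub>F n in sequentially. real (\<tau> n) \<le> c ^ n"
  shows "\<exists>C\<ge>1. \<forall>n. real (\<Sum>i\<le>n. \<tau> i) \<le> C * real (n + 1) * c ^ n"
proof -
  obtain N where N: "\<And>n. n \<ge> N \<Longrightarrow> real (\<tau> n) \<le> c ^ n"
    using ev unfolding eventually_sequentially by blast
  define C where "C = 1 + (\<Sum>i<N. real (\<tau> i))"
  have C: "C \<ge> 1"
    by (simp add: C_def sum_nonneg)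
  have "real (\<tau> i) \<le> C * c ^ n" if "i \<le> n" for i n
  proof (cases "i \<ge> N")
    case True
    then have "real (\<tau> i) \<le> 1 * c ^ i"
      using N by simp
    also have "\<dots> \<le> C * c ^ n"
      using C c that by (intro mult_mono power_increasing) auto
    finally show ?thesis .
  next
    case False
    then have "real (\<tau> i) \<le> (\<Sum>i<N. real (\<tau> i))"
      by (intro member_le_sum) auto
    also have "\<dots> \<le> C * 1"
      by (simp add: C_def)
    also have "\<dots> \<le> C * c ^ n"
      using C c by (intro mult_left_mono one_le_power) auto
    finally show ?thesis .
  qed
  then have "real (\<Sum>i\<le>n. \<tau> i) \<le> real (card {..n}) * (C * c ^ n)" for n
    unfolding of_nat_sum by (intro sum_bounded_above) auto
  then have "real (\<Sum>i\<le>n. \<tau> i) \<le> C * real (n + 1) * c ^ n" for n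
    by (simp add: mult_ac)
  with C show ?thesis
    by blast
qed

text \<open>The n-th roots of \<open>C\<close>, 2 and \<open>n\<close> tend to 1, so a linear factor
  does not affect the limit superior.\<close>

lemma limsup_root_le:
  fixes \<sigma> :: "nat \<Rightarrow> nat"
  assumes c: "c \<ge> 1" and C: "C \<ge> 1" and le: "\<And>n. real (\<sigma> n) \<le> C * real (n + 1) * c ^ n"
  shows "limsup (\<lambda>n. ereal (root n (real (\<sigma> n)))) \<le> ereal c"
proof -
  have le': "root n (real (\<sigma> n)) \<le> root n C * (root n 2 * root n (real n)) * c" if "n > 0" for n
  proof -
    have "real (\<sigma> n) \<le> C * (2 * real n) * c ^ n"
      using C c that by (intro order_trans[OF le] mult_mono) auto
    then have "root n (real (\<sigma> n)) \<le> root n (C * (2 * real n) * c ^ n)"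
      using that by simp
    also have "\<dots> = root n C * (root n 2 * root n (real n)) * c"
      using that c by (simp add: real_root_mult real_root_power_cancel)
    finally show ?thesis .
  qed
  have "(\<lambda>n. root n C * (root n 2 * root n (real n)) * c) \<longlonglongrightarrow> 1 * (1 * 1) * c"
    using C by (intro tendsto_mult tendsto_const LIMSEQ_root_const LIMSEQ_root) auto
  then have lim: "(\<lambda>n. ereal (root n C * (root n 2 * root n (real n)) * c)) \<longlonglongrightarrow> ereal c"
    by simp
  have "limsup (\<lambda>n. ereal (root n (real (\<sigma> n))))
      \<le> limsup (\<lambda>n. ereal (root n C * (root n 2 * root n (real n)) * c))"
    by (rule Limsup_mono) (use le' in \<open>auto simp: eventually_sequentially intro!: exI[of _ 1]\<close>)
  also have "\<dots> = ereal c"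
    by (intro lim_imp_Limsup lim) simp
  finally show ?thesis .
qed

text \<open>The series converges, so its terms tend to 0, and a natural number below 1 is 0.\<close>

lemma bounded_sum_eventually_zero:
  fixes \<sigma> :: "nat \<Rightarrow> nat"
  assumes "\<And>n. (\<Sum>i\<le>n. \<sigma> i) \<le> B"
  shows "\<forall>\<^sub>F n in sequentially. \<sigma> n = 0"
proof -
  have "summable (\<lambda>n. real (\<sigma> n))"
  proof (rule bounded_imp_summable[where B = "real B"])
    show "(\<Sum>i\<le>n. real (\<sigma> i)) \<le> real B" for n
      using assms[of n] by (metis of_nat_le_iff of_nat_sum)
  qed simp
  then have "(\<lambda>n. real (\<sigma> n)) \<longlonglongrightarrow> 0"
    by (rule summable_LIMSEQ_zero)
  then have "\<forall>\<^sub>F n in sequentially. real (\<sigma> n) < 1"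
    by (rule order_tendstoD) simp
  then show ?thesis
    by eventually_elim simp
qed

text \<open>If \<open>c \<ge> 1\<close> lies strictly above the limit superior for \<tau>, then the
  powers of \<open>c\<close> eventually bound the terms of \<tau>, hence bound its partial sums up
  to a linear factor, and hence each term of \<sigma>.\<close>

lemma limsup_root_mono:
  fixes \<sigma> \<tau> :: "nat \<Rightarrow> nat"
  assumes le: "\<And>n. (\<Sum>i\<le>n. \<sigma> i) \<le> (\<Sum>i\<le>n. \<tau> i)"
  shows "limsup (\<lambda>n. ereal (root n (real (\<sigma> n)))) \<le> limsup (\<lambda>n. ereal (root n (real (\<tau> n))))"
    (is "?L \<sigma> \<le> ?L \<tau>")
proof (cases "?L \<tau> < 1")
  \<comment> \<open>Finite groups fall under this case. Natural numbers with roots below 1 vanish,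
    so both sequences are eventually 0.\<close>
  case True
  then have "\<forall>\<^sub>F n in sequentially. ereal (root n (real (\<tau> n))) < 1"
    by (rule Limsup_lessD)
  then have "\<forall>\<^sub>F n in sequentially. \<tau> n = 0"
    using eventually_gt_at_top[of 0]
  proof eventually_elim
    case (elim n)
    then have "real (\<tau> n) < 1"
      by (simp add: one_ereal_def)
    then show ?case
      by simp
  qed
  then obtain N where N: "\<And>n. n \<ge> N \<Longrightarrow> \<tau> n = 0"
    unfolding eventually_sequentially by blast
  have "(\<Sum>i\<le>n. \<sigma> i) \<le> (\<Sum>i<N. \<tau> i)" for n
  proof -
    have "(\<Sum>i\<le>n. \<tau> i) = (\<Sum>i\<in>{..n} \<inter> {..<N}. \<tau> i)"
      using N by (intro sum.mono_neutral_right) (auto simp: not_less)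
    also have "\<dots> \<le> (\<Sum>i<N. \<tau> i)"
      by (intro sum_mono2) auto
    finally show ?thesis
      using le[of n] by simp
  qed
  then have "\<forall>\<^sub>F n in sequentially. \<sigma> n = 0"
    by (rule bounded_sum_eventually_zero)
  then have "?L \<sigma> = limsup (\<lambda>n. 0)"
    by (intro Limsup_eq) (auto elim!: eventually_mono simp: zero_ereal_def)
  also have "\<dots> \<le> ?L \<tau>"
    by (intro Limsup_mono always_eventually) (simp add: zero_ereal_def real_root_ge_zero)
  finally show ?thesis .
next
  case False
  show ?thesis
  proof (rule ccontr)
    assume "\<not> ?L \<sigma> \<le> ?L \<tau>"
    then obtain c where c: "?L \<tau> < ereal c" "ereal c < ?L \<sigma>"
      using ereal_dense2 by (meson not_le)
    have "1 < ereal c"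
      using False c(1) by (meson le_less_trans not_le)
    then have c1: "c \<ge> 1"
      by (simp add: one_ereal_def)
    have "\<forall>\<^sub>F n in sequentially. ereal (root n (real (\<tau> n))) < ereal c"
      using c(1) by (rule Limsup_lessD)
    then have "\<forall>\<^sub>F n in sequentially. real (\<tau> n) \<le> c ^ n"
      using eventually_gt_at_top[of 0]
      by eventually_elim (auto intro: root_le_imp_le_power)
    then obtain C where C: "C \<ge> 1" "\<And>n. real (\<Sum>i\<le>n. \<tau> i) \<le> C * real (n + 1) * c ^ n"
      using sum_le_geometric[OF c1] by blast
    have "real (\<sigma> n) \<le> C * real (n + 1) * c ^ n" for n
    proof -
      have "\<sigma> n \<le> (\<Sum>i\<le>n. \<sigma> i)"
        by (intro member_le_sum) auto
      also have "\<dots> \<le> (\<Sum>i\<le>n. \<tau> i)"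
        by (rule le)
      finally show ?thesis
        using C(2)[of n] by linarith
    qed
    then have "?L \<sigma> \<le> ereal c"
      by (rule limsup_root_le[OF c1 C(1)])
    with c(2) show False
      by simp
  qed
qed

section \<open>Balls and spheres in the word metric\<close>

context group begin

definition word_generates :: "'a set \<Rightarrow> bool" where
  "word_generates A \<longleftrightarrow> A \<subseteq> carrier G \<and> (\<forall>g \<in> carrier G. \<exists>xs. set xs \<subseteq> A \<and> word_prod G xs = g)"

lemma word_length_le:
  assumes "set xs \<subseteq> A"
  shows "word_length G A (word_prod G xs) \<le> length xs"
  unfolding word_length_def using assms by (intro Least_le) blast

lemma finite_word_ball:
  assumes fin: "finite A" and gen: "word_generates A"
  shows "finite {g \<in> carrier G. word_length G A g \<le> n}"
proof (rule finite_subset)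
  let ?A = "A \<union> (\<lambda>s. inv s) ` A"
  show "{g \<in> carrier G. word_length G A g \<le> n} \<subseteq> word_prod G ` {xs. set xs \<subseteq> ?A \<and> length xs \<le> n}"
  proof
    fix g
    assume g: "g \<in> {g \<in> carrier G. word_length G A g \<le> n}"
    then obtain ys where "set ys \<subseteq> A" "word_prod G ys = g"
      using gen unfolding word_generates_def by blast
    then have "\<exists>m xs. length xs = m \<and> set xs \<subseteq> ?A \<and> g = word_prod G xs"
      by blast
    from LeastI_ex[OF this] obtain xs where "length xs = word_length G A g" "set xs \<subseteq> ?A" "g = word_prod G xs"
      unfolding word_length_def by blast
    then show "g \<in> word_prod G ` {xs. set xs \<subseteq> ?A \<and> length xs \<le> n}"
      using g by auto
  qed
  show "finite (word_prod G ` {xs. set xs \<subseteq> ?A \<and> length xs \<le> n})"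
    using fin by (intro finite_imageI finite_lists_length_le) simp
qed

lemma sum_card_spheres:
  assumes fin: "finite A" and gen: "word_generates A"
  shows "(\<Sum>i\<le>n. card {g \<in> carrier G. word_length G A g = i}) = card {g \<in> carrier G. word_length G A g \<le> n}"
proof -
  have "{g \<in> carrier G. word_length G A g \<le> n} = (\<Union>i\<le>n. {g \<in> carrier G. word_length G A g = i})"
    by auto
  also have "card \<dots> = (\<Sum>i\<le>n. card {g \<in> carrier G. word_length G A g = i})"
  proof (rule card_UN_disjoint)
    show "\<forall>i\<in>{..n}. finite {g \<in> carrier G. word_length G A g = i}"
      by (auto intro: finite_subset[OF _ finite_word_ball[OF fin gen, of n]])
  qed auto
  finally show ?thesis ..
qed

text \<open>The image under \<open>p\<close> of the \<open>B\<close>-ball of radius \<open>n\<close>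
  contains the \<open>A\<close>-ball of that radius, so the latter has at most as many elements.
  Cardinalities of balls are the partial sums of those of spheres.\<close>

lemma growth_rate_mono:
  assumes A: "finite A" "word_generates A" and B: "finite B" "word_generates B"
    and surj: "\<And>g. g \<in> carrier G \<Longrightarrow> \<exists>x \<in> carrier G. p x = g \<and> word_length G B x \<le> word_length G A g"
  shows "growth_rate G A \<le> growth_rate G B"
  unfolding growth_rate_def
proof (rule limsup_root_mono)
  fix n
  have "{g \<in> carrier G. word_length G A g \<le> n} \<subseteq> p ` {g \<in> carrier G. word_length G B g \<le> n}"
  proof
    fix g
    assume g: "g \<in> {g \<in> carrier G. word_length G A g \<le> n}"
    then obtain x where "x \<in> carrier G" "p x = g" "word_length G B x \<le> word_length G A g"
      using surj by blast
    with g show "g \<in> p ` {g \<in> carrier G. word_length G B g \<le> n}"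
      by (intro image_eqI[of _ _ x]) auto
  qed
  then have "card {g \<in> carrier G. word_length G A g \<le> n} \<le> card {g \<in> carrier G. word_length G B g \<le> n}"
    using finite_word_ball[OF B] by (meson card_image_le card_mono finite_imageI order_trans)
  then show "(\<Sum>i\<le>n. card {g \<in> carrier G. word_length G A g = i})
      \<le> (\<Sum>i\<le>n. card {g \<in> carrier G. word_length G B g = i})"
    unfolding sum_card_spheres[OF A] sum_card_spheres[OF B] .
qed

end

lemma (in pseudo_coxeter) growth_rate_le: "growth_rate W S \<le> growth_rate W T"
proof (rule growth_rate_mono[where p = psi])
  show "finite S" "finite T"
    using finite_S by simp_all
  show "word_generates S"
    unfolding word_generates_def using S_carrier reduced_word_S by metis
  show "word_generates T"
    unfolding word_generates_def using T_carrier T_words by blast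
  fix g
  assume g: "g \<in> carrier W"
  then obtain ys where ys: "set ys \<subseteq> T" "length ys \<le> len g" "psi (word_prod W ys) = g"
    using psi_surj by blast
  then have "word_prod W ys \<in> carrier W"
    using T_carrier by (intro word_prod_closed) blast
  moreover have "word_length W T (word_prod W ys) \<le> word_length W S g"
    using word_length_le[OF ys(1)] ys(2) word_length_eq[OF g] by simp
  ultimately show "\<exists>x \<in> carrier W. psi x = g \<and> word_length W T x \<le> word_length W S g"
    using ys(3) by blast
qed

theorem theorem1p2:
  fixes W :: "('a, 'b) monoid_scheme" (structure)
    and S T :: "'a set" and s0 s1 s2 r :: 'a and k :: nat
  assumes "coxeter_system W S"
    and "pseudo_transposition W S s1"
    and "s0 \<in> S" and "k \<ge> 1" and "coxeter_m W s0 s1 = enat (2 * (2 * k + 1))"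
    and "s2 = s1 \<otimes> s0 \<otimes> s1"
    and "r = (s1 \<otimes> s0) [^] (2 * k + 1)"
    and "T = (S - {s1}) \<union> {s2, r}"
  shows "growth_rate W T \<ge> growth_rate W S"
proof -
  interpret coxeter W S
    using assms(1) by (auto simp: coxeter_def coxeter_axioms_def coxeter_system_def)
  have m: "\<exists>k::nat. k \<ge> 1 \<and> coxeter_m W s0 s1 = enat (2 * (2 * k + 1))"
    using assms(4,5) by blast
  have s1: "s1 \<in> S"
    using assms(2) unfolding pseudo_transposition_def by blast
  have m2: "coxeter_m W s s1 \<in> {2, \<infinity>}" and m3: "coxeter_m W s s1 = 2 \<Longrightarrow> coxeter_m W s s0 = 2"
    if "s \<in> S - {s0, s1}" for s
    using assms(2,3) m that unfolding pseudo_transposition_def by blast+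
  \<comment> \<open>The order of \<open>s1 \<otimes> s1\<close> is 1, which is not of the form
    \<open>2 * (2 * k + 1)\<close>.\<close>
  have "s0 \<noteq> s1"
    using assms(5) s1 by (auto simp: coxeter_m_def)
  interpret pseudo_coxeter W S s0 s1 k
    by unfold_locales (use assms(3,4,5) s1 \<open>s0 \<noteq> s1\<close> m2 m3 in auto)
  show ?thesis
    using growth_rate_le unfolding assms(6-8) D.c_def D.r_def .
qed

end
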